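(* Let $K\subset\Sigma$ be the graph knot in a homology sphere obtained by splicing the 3-component necklace with two right-handed trefoils, as defined in the context, let $\pi_1(K)$ denote the fundamental group of its exterior, with the generators $x,y,n,s,t,a,b$ described in the context, and let $\phi:\pi_1(K)\to\mathbb{Z}$ be the abelianization map, given by $\phi(x)=\phi(y)=\phi(n)=\phi(s)=0$ and $\phi(a)=\phi(b)=\phi(t)=1$. Let $\alpha:\pi_1(K)\to S_5\to GL_5(\mathbb{Z})$ be the representation (the second map being the permutation representation) given, in one-line permutation notation, by $$\alpha(a)=(15234),\ \alpha(b)=(13524),\ \alpha(n)=(14523),\ \alpha(s)=(12345),$$ $$\alpha(t)=(15234),\ \alpha(x)=(14523),\ \alpha(y)=(34125).$$ Then the twisted Alexander polynomial $\Delta_{K,\phi}^{\alpha}$ is not monic.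
   Context: A homology sphere is a closed oriented 3-manifold with the integral homology of $S^3$. For an oriented link in a homology sphere, each component has a standard meridian $\mu$ and a standard longitude $\lambda$ (parallel to the component, with linking number $0$ with that component). The splice of $(\Sigma',L')$ and $(\Sigma'',L'')$ along components $S'\subset L'$ and $S''\subset L''$ is the homology sphere obtained from $(\Sigma'\setminus\nu S')\cup(\Sigma''\setminus\nu S'')$ by gluing boundary tori so that $\mu(S')=\lambda(S'')$ and $\lambda(S')=\mu(S'')$, together with the link $(L'\setminus S')\cup(L''\setminus S'')$. The 3-component necklace is the link $N_0\cup N_1\cup N_2\subset S^3$, where $N_0$ is an unknot and $N_1,N_2$ are unknots bounding disjoint disks each meeting $N_0$ transversally in one point, oriented so that $\mathrm{lk}(N_0,N_i)=1$. Definition of $K\subset \Sigma$: splice the necklace along $N_1$ with a right-handed trefoil $T_L\subset S^3$, and along $N_0$ with another right-handed trefoil $T_R\subset S^3$; $K$ is the image of $N_2$. Generators of $\pi_1(K)=\pi_1(\Sigma\setminus\nu(K))$: the necklace exterior has group $\langle n,s,t\mid ns=sn, nt=tn\rangle$ with $n,s,t$ meridians of $N_0,N_1,N_2$ and $\lambda(N_0)=st$, $\lambda(N_1)=n$; $\pi_1(T_L)=\langle x,y\mid xyx=yxy\rangle$ with meridian $x$ and longitude $x^{-1}yx^2yx^{-3}$; $\pi_1(T_R)=\langle a,b\mid aba=bab\rangle$ with meridian $a$ and longitude $a^{-1}ba^2ba^{-3}$. Then $$\pi_1(K)=\langle x,y,n,s,t,a,b\mid xyx=yxy,\ aba=bab,\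 ns=sn,\ nt=tn,\ x=n,\ s=x^{-1}yx^2yx^{-3},\ st=a,\ n=a^{-1}ba^2ba^{-3}\rangle.$$ One-line notation $(i_1i_2i_3i_4i_5)$ denotes the permutation $j\mapsto i_j$. Twisted Alexander polynomial: for a compact 3-manifold $X$, $\phi\in H^1(X;\mathbb{Z})=\mathrm{Hom}(\pi_1(X),\mathbb{Z})$ and $\alpha:\pi_1(X)\to GL_k(\mathbb{Z})$, let $\pi_1(X)$ act on $\mathbb{Z}^k\otimes\mathbb{Z}[t^{\pm1}]$ by $g\cdot(v\otimes p)=\alpha(g)v\otimes t^{\phi(g)}p$. $\Delta_{X,\phi}^\alpha\in\mathbb{Z}[t^{\pm1}]$ is the order of the $\mathbb{Z}[t^{\pm1}]$-module $H_1(X;\mathbb{Z}^k[t^{\pm1}])$ (the generator of the smallest principal ideal containing its zeroth Fitting ideal), defined up to multiplication by units $\pm t^i$. It is monic if it is nonzero with leading coefficient $\pm1$; in particular, the zero polynomial is not monic. $\Delta^\alpha_{K,\phi}$ means $\Delta^\alpha_{X,\phi}$ for $X=\Sigma\setminus\nu(K)$. *)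

theory Defs
  imports
    "HOL-Homology.Homology"
    "HOL-Library.Poly_Mapping"
    "HOL-Algebra.Sym_Groups"
    "Jordan_Normal_Form.Determinant"
begin

section \<open>Path classes and the fundamental group of an abstract topology\<close>

text \<open>The operations \<open>+++\<close> and \<open>reversepath\<close> of HOL-Analysis are restricted to types of class
  \<open>topological_space\<close>; glued spaces are only given as abstract topologies.\<close>

definition path_join :: "(real \<Rightarrow> 'a) \<Rightarrow> (real \<Rightarrow> 'a) \<Rightarrow> real \<Rightarrow> 'a" where
  "path_join c d = (\<lambda>s. if s \<le> 1/2 then c (2 * s) else d (2 * s - 1))"

definition path_reverse :: "(real \<Rightarrow> 'a) \<Rightarrow> real \<Rightarrow> 'a" where
  "path_reverse c = (\<lambda>s. c (1 - s))"

definition path_from_to :: "'a topology \<Rightarrow> 'a \<Rightarrow> 'a \<Rightarrow> (real \<Rightarrow> 'a) \<Rightarrow> bool" where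
  "path_from_to X p q c \<longleftrightarrow> pathin X c \<and> c 0 = p \<and> c 1 = q"

definition path_class :: "'a topology \<Rightarrow> (real \<Rightarrow> 'a) \<Rightarrow> (real \<Rightarrow> 'a) set" where
  "path_class X c =
     {d. homotopic_with (\<lambda>h. h 0 = c 0 \<and> h 1 = c 1) (top_of_set {0..1}) X c d}"

definition path_classes :: "'a topology \<Rightarrow> 'a \<Rightarrow> 'a \<Rightarrow> (real \<Rightarrow> 'a) set set" where
  "path_classes X p q = {path_class X c | c. path_from_to X p q c}"

definition class_mult ::
    "'a topology \<Rightarrow> (real \<Rightarrow> 'a) set \<Rightarrow> (real \<Rightarrow> 'a) set \<Rightarrow> (real \<Rightarrow> 'a) set" where
  "class_mult X A B = (\<Union>c\<in>A. \<Union>d\<in>B. path_class X (path_join c d))"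

definition fundamental_group :: "'a topology \<Rightarrow> 'a \<Rightarrow> (real \<Rightarrow> 'a) set monoid" where
  "fundamental_group X p =
     \<lparr>carrier = path_classes X p p, monoid.mult = class_mult X, one = path_class X (\<lambda>_. p)\<rparr>"

text \<open>The class of the loop that runs along \<open>d\<close>, then around \<open>c\<close>, then back along \<open>d\<close>.\<close>

definition based_class :: "'a topology \<Rightarrow> (real \<Rightarrow> 'a) \<Rightarrow> (real \<Rightarrow> 'a) \<Rightarrow> (real \<Rightarrow> 'a) set" where
  "based_class X d c = path_class X (path_join d (path_join c (path_reverse d)))"


section \<open>Group presentations\<close>

text \<open>In a word, \<open>(g, True)\<close> stands for the generator \<open>g\<close> and \<open>(g, False)\<close> for its inverse.
  Relations are pairs of words; \<open>word_eq R\<close> is equality in the group with relations \<open>R\<close>.\<close>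

inductive word_eq ::
    "(('s \<times> bool) list \<times> ('s \<times> bool) list) set \<Rightarrow> ('s \<times> bool) list \<Rightarrow> ('s \<times> bool) list \<Rightarrow> bool"
  for R where
  relation: "(u, v) \<in> R \<Longrightarrow> word_eq R u v"
| cancel: "word_eq R [(g, e), (g, \<not> e)] []"
| refl: "word_eq R u u"
| sym: "word_eq R u v \<Longrightarrow> word_eq R v u"
| trans: "word_eq R u v \<Longrightarrow> word_eq R v w \<Longrightarrow> word_eq R u w"
| congr: "word_eq R u v \<Longrightarrow> word_eq R (l @ u @ r) (l @ v @ r)"

primrec word_value :: "('g, 'm) monoid_scheme \<Rightarrow> ('s \<Rightarrow> 'g) \<Rightarrow> ('s \<times> bool) list \<Rightarrow> 'g" where
  "word_value G f [] = \<one>\<^bsub>G\<^esub>"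
| "word_value G f (l # w) =
     (if snd l then f (fst l) else inv\<^bsub>G\<^esub> f (fst l)) \<otimes>\<^bsub>G\<^esub> word_value G f w"

text \<open>\<open>G\<close> is presented by generators \<open>S\<close> and relations \<open>R\<close>, with \<open>s \<in> S\<close> standing for \<open>f s\<close>.\<close>

definition has_presentation ::
    "('g, 'm) monoid_scheme \<Rightarrow> 's set \<Rightarrow> ('s \<Rightarrow> 'g) \<Rightarrow>
      (('s \<times> bool) list \<times> ('s \<times> bool) list) set \<Rightarrow> bool" where
  "has_presentation G S f R \<longleftrightarrow>
     group G \<and> f ` S \<subseteq> carrier G \<and>
     carrier G = word_value G f ` lists (S \<times> UNIV) \<and>
     (\<forall>u \<in> lists (S \<times> UNIV). \<forall>v \<in> lists (S \<times> UNIV).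
        word_value G f u = word_value G f v \<longleftrightarrow> word_eq R u v)"


section \<open>Twisted homology\<close>

text \<open>The ring \<open>\<int>[t\<^sup>\<plusminus>\<^sup>1]\<close> is the group ring of \<open>\<int>\<close>: finitely supported functions
  from exponents to coefficients, with the convolution product.\<close>

type_synonym laurent = "int \<Rightarrow>\<^sub>0 int"

definition t_pow :: "int \<Rightarrow> laurent" where
  "t_pow i = Poly_Mapping.single i 1"

definition monic_laurent :: "laurent \<Rightarrow> bool" where
  "monic_laurent p \<longleftrightarrow> p \<noteq> 0 \<and> Poly_Mapping.lookup p (Max (Poly_Mapping.keys p)) \<in> {1, -1}"

text \<open>A singular simplex of the universal cover of \<open>X\<close> (whose points are the classes of paths
  starting at \<open>p\<close>) is the same thing as a singular simplex \<open>\<sigma>\<close> of \<open>X\<close> together with a lift of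
  its vertex 0, that is, a class of paths from \<open>p\<close> to that vertex. The face opposite to
  vertex 0 starts at vertex 1, so there the path class is extended along the edge from
  vertex 0 to vertex 1; all other faces keep vertex 0.\<close>

type_synonym 'a lifted_simplex = "((nat \<Rightarrow> real) \<Rightarrow> 'a) \<times> (real \<Rightarrow> 'a) set"

definition vertex :: "nat \<Rightarrow> nat \<Rightarrow> real" where
  "vertex i = (\<lambda>j. if j = i then 1 else 0)"

definition first_edge :: "((nat \<Rightarrow> real) \<Rightarrow> 'a) \<Rightarrow> real \<Rightarrow> 'a" where
  "first_edge \<sigma> = (\<lambda>s. \<sigma> (\<lambda>j. (1 - s) * vertex 0 j + s * vertex 1 j))"

definition lifted_simplices :: "nat \<Rightarrow> 'a topology \<Rightarrow> 'a \<Rightarrow> 'a lifted_simplex set" where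
  "lifted_simplices k X p =
     {(\<sigma>, c). singular_simplex k X \<sigma> \<and> c \<in> path_classes X p (\<sigma> (vertex 0))}"

definition lifted_face ::
    "nat \<Rightarrow> 'a topology \<Rightarrow> nat \<Rightarrow> 'a lifted_simplex \<Rightarrow> 'a lifted_simplex" where
  "lifted_face k X m = (\<lambda>(\<sigma>, c).
     (singular_face k m \<sigma>, if m = 0 then class_mult X c (path_class X (first_edge \<sigma>)) else c))"

text \<open>The chains of the universal cover with coefficients in \<open>\<int>\<^sup>n \<otimes> \<int>[t\<^sup>\<plusminus>\<^sup>1]\<close> form the free
  \<open>\<int>[t\<^sup>\<plusminus>\<^sup>1]\<close>-module on pairs of a lifted simplex and a standard basis vector \<open>e\<^sub>i\<close>, \<open>i < n\<close>.\<close>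

type_synonym 'a twisted_chain = "('a lifted_simplex \<times> nat) \<Rightarrow>\<^sub>0 laurent"

definition scale :: "'r::comm_ring_1 \<Rightarrow> ('b \<Rightarrow>\<^sub>0 'r) \<Rightarrow> ('b \<Rightarrow>\<^sub>0 'r)" where
  "scale r f = Poly_Mapping.map ((*) r) f"

definition chains :: "nat \<Rightarrow> 'a topology \<Rightarrow> 'a \<Rightarrow> nat \<Rightarrow> 'a twisted_chain set" where
  "chains k X p n = {f. Poly_Mapping.keys f \<subseteq> lifted_simplices k X p \<times> {..<n}}"

definition boundary :: "nat \<Rightarrow> 'a topology \<Rightarrow> 'a twisted_chain \<Rightarrow> 'a twisted_chain" where
  "boundary k X f =
     (if k = 0 then 0
      else \<Sum>(s, i)\<in>Poly_Mapping.keys f. \<Sum>m\<le>k.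
        Poly_Mapping.single (lifted_face k X m s, i) ((- 1) ^ m * Poly_Mapping.lookup f (s, i)))"

text \<open>Passing from \<open>C\<^sub>k \<otimes>\<^bsub>\<int>\<^esub> M\<close> to \<open>C\<^sub>k \<otimes>\<^bsub>\<int>[\<pi>]\<^esub> M\<close>, with \<open>C\<^sub>k\<close> the chains of the universal cover
  and \<open>M = \<int>\<^sup>n \<otimes> \<int>[t\<^sup>\<plusminus>\<^sup>1]\<close>, amounts to dividing by all \<open>g \<sigma> \<otimes> g m - \<sigma> \<otimes> m\<close>, where
  \<open>g e\<^sub>i = t\<^bsup>\<phi>(g)\<^esup> \<alpha>(g) e\<^sub>i\<close>.\<close>

definition action_relations ::
    "nat \<Rightarrow> 'a topology \<Rightarrow> 'a \<Rightarrow> nat \<Rightarrow> ((real \<Rightarrow> 'a) set \<Rightarrow> int) \<Rightarrow>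
      ((real \<Rightarrow> 'a) set \<Rightarrow> int mat) \<Rightarrow> 'a twisted_chain set" where
  "action_relations k X p n \<phi> \<alpha> = module.span scale
     {(\<Sum>j<n. Poly_Mapping.single ((\<sigma>, class_mult X g c), j) (of_int (\<alpha> g $$ (j, i)) * t_pow (\<phi> g)))
        - Poly_Mapping.single ((\<sigma>, c), i) 1
      | g \<sigma> c i. g \<in> carrier (fundamental_group X p) \<and> (\<sigma>, c) \<in> lifted_simplices k X p \<and> i < n}"

text \<open>\<open>H\<^sub>k(X; \<int>\<^sup>n[t\<^sup>\<plusminus>\<^sup>1])\<close> is the quotient of \<open>twisted_cycles\<close> by \<open>twisted_boundaries\<close>.\<close>

definition twisted_cycles ::
    "nat \<Rightarrow> 'a topology \<Rightarrow> 'a \<Rightarrow> nat \<Rightarrow> ((real \<Rightarrow> 'a) set \<Rightarrow> int) \<Rightarrow>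
      ((real \<Rightarrow> 'a) set \<Rightarrow> int mat) \<Rightarrow> 'a twisted_chain set" where
  "twisted_cycles k X p n \<phi> \<alpha> =
     {f \<in> chains k X p n. boundary k X f \<in> action_relations (k - 1) X p n \<phi> \<alpha>}"

definition twisted_boundaries ::
    "nat \<Rightarrow> 'a topology \<Rightarrow> 'a \<Rightarrow> nat \<Rightarrow> ((real \<Rightarrow> 'a) set \<Rightarrow> int) \<Rightarrow>
      ((real \<Rightarrow> 'a) set \<Rightarrow> int mat) \<Rightarrow> 'a twisted_chain set" where
  "twisted_boundaries k X p n \<phi> \<alpha> =
     {boundary (Suc k) X h + d | h d. h \<in> chains (Suc k) X p n \<and> d \<in> action_relations k X p n \<phi> \<alpha>}"


section \<open>Orders of modules and the twisted Alexander polynomial\<close>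

text \<open>The zeroth Fitting ideal of the quotient \<open>Z / B\<close> of two submodules of \<open>'b \<Rightarrow>\<^sub>0 'r\<close>,
  assumed finitely generated. For any single finite generating family \<open>zs\<close> of \<open>Z / B\<close> it is
  generated by the determinants of the square matrices whose rows are relations among \<open>zs\<close>;
  as it does not depend on \<open>zs\<close>, all finite generating families are used at once.\<close>

definition fitting_ideal :: "('b \<Rightarrow>\<^sub>0 'r::comm_ring_1) set \<Rightarrow> ('b \<Rightarrow>\<^sub>0 'r) set \<Rightarrow> 'r set" where
  "fitting_ideal Z B = module.span (*)
     {Determinant.det A | A zs.
        set zs \<subseteq> Z \<and> Z \<subseteq> module.span scale (set zs \<union> B) \<and>
        A \<in> carrier_mat (length zs) (length zs) \<and>
        (\<forall>i<length zs. (\<Sum>j<length zs. scale (A $$ (i, j)) (zs ! j)) \<in> B)}"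

definition is_order :: "('b \<Rightarrow>\<^sub>0 'r::comm_ring_1) set \<Rightarrow> ('b \<Rightarrow>\<^sub>0 'r) set \<Rightarrow> 'r \<Rightarrow> bool" where
  "is_order Z B d \<longleftrightarrow>
     fitting_ideal Z B \<subseteq> {r. d dvd r} \<and>
     (\<forall>e. fitting_ideal Z B \<subseteq> {r. e dvd r} \<longrightarrow> {r. d dvd r} \<subseteq> {r. e dvd r})"

text \<open>Only defined up to units; \<open>n\<close> is the rank of the representation \<open>\<alpha>\<close> and \<open>p\<close> is the base point.\<close>

definition twisted_alexander_polynomial ::
    "'a topology \<Rightarrow> 'a \<Rightarrow> nat \<Rightarrow> ((real \<Rightarrow> 'a) set \<Rightarrow> int) \<Rightarrow> ((real \<Rightarrow> 'a) set \<Rightarrow> int mat) \<Rightarrow> laurent"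
  where
  "twisted_alexander_polynomial X p n \<phi> \<alpha> =
     (SOME d. is_order (twisted_cycles 1 X p n \<phi> \<alpha>) (twisted_boundaries 1 X p n \<phi> \<alpha>) d)"


section \<open>Permutation representations\<close>

definition one_line :: "nat list \<Rightarrow> nat \<Rightarrow> nat" where
  "one_line is = (\<lambda>j. if j \<in> {1..length is} then is ! (j - 1) else j)"

text \<open>The matrix of \<open>e\<^sub>j \<mapsto> e\<^bsub>\<rho>(j)\<^esub>\<close>; permutations act on \<open>{1..n}\<close>, matrix indices start at 0.\<close>

definition permutation_matrix :: "nat \<Rightarrow> (nat \<Rightarrow> nat) \<Rightarrow> int mat" where
  "permutation_matrix n \<rho> = mat n n (\<lambda>(i, j). if \<rho> (j + 1) = i + 1 then 1 else 0)"


section \<open>Knots in the three-sphere and splicing\<close>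

definition three_sphere :: "(complex \<times> complex) set" where
  "three_sphere = sphere 0 1"

definition frame_det ::
    "complex \<times> complex \<Rightarrow> complex \<times> complex \<Rightarrow> complex \<times> complex \<Rightarrow> complex \<times> complex \<Rightarrow> real" where
  "frame_det a b c d = Determinant.det (mat_of_rows_list 4
     (map (\<lambda>(z, w). [Re z, Im z, Re w, Im w]) [a, b, c, d]))"

text \<open>A tubular neighbourhood of the oriented knot \<open>K\<close> (parametrised by the unit circle),
  compatible with the orientation of the three-sphere as the boundary of the unit ball
  (outward normal first), whose coordinates on the boundary torus of \<open>S\<^sup>1 \<times> D\<^sup>2\<close> are standard:
  \<open>v \<mapsto> \<tau> (1, v)\<close> is the meridian, and \<open>u \<mapsto> \<tau> (u, 1)\<close> is the longitude, linking number 0 with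
  \<open>K\<close> being expressed as null-homologous in the complement of \<open>K\<close>. The map is defined on discs
  of radius 2, so that the boundary of the closed neighbourhood is collared on both sides.\<close>

definition framed_nbhd ::
    "(complex \<Rightarrow> complex \<times> complex) \<Rightarrow> (complex \<times> complex \<Rightarrow> complex \<times> complex) \<Rightarrow> bool" where
  "framed_nbhd K \<tau> \<longleftrightarrow>
     continuous_on (sphere 0 1 \<times> ball 0 2) \<tau> \<and>
     inj_on \<tau> (sphere 0 1 \<times> ball 0 2) \<and>
     \<tau> ` (sphere 0 1 \<times> ball 0 2) \<subseteq> three_sphere \<and>
     (\<forall>u \<in> sphere 0 1. \<tau> (u, 0) = K u) \<and>
     (\<forall>s::real. \<forall>v \<in> ball 0 2. \<exists>D.
        ((\<lambda>(s, v). \<tau> (cis s, v)) has_derivative D) (at (s, v)) \<and>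
        frame_det (\<tau> (cis s, v)) (D (1, 0)) (D (0, 1)) (D (0, \<i>)) > 0) \<and>
     trivial_homomorphism
       (homology_group 1 (top_of_set (sphere (0::complex) 1)))
       (homology_group 1 (top_of_set (three_sphere - K ` sphere 0 1)))
       (hom_induced 1 (top_of_set (sphere (0::complex) 1)) {}
         (top_of_set (three_sphere - K ` sphere 0 1)) {} (\<lambda>u. \<tau> (u, 1)))"

definition closed_nbhd :: "(complex \<times> complex \<Rightarrow> 'a) \<Rightarrow> 'a set" where
  "closed_nbhd \<tau> = \<tau> ` (sphere 0 1 \<times> cball 0 1)"

definition open_nbhd :: "(complex \<times> complex \<Rightarrow> 'a) \<Rightarrow> 'a set" where
  "open_nbhd \<tau> = \<tau> ` (sphere 0 1 \<times> ball 0 1)"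

definition remove_nbhd :: "'a topology \<Rightarrow> (complex \<times> complex \<Rightarrow> 'a) \<Rightarrow> 'a topology" where
  "remove_nbhd M \<tau> = subtopology M (topspace M - open_nbhd \<tau>)"

definition meridian :: "(complex \<times> complex \<Rightarrow> 'a) \<Rightarrow> real \<Rightarrow> 'a" where
  "meridian \<tau> = (\<lambda>s. \<tau> (1, cis (2 * pi * s)))"

definition longitude :: "(complex \<times> complex \<Rightarrow> 'a) \<Rightarrow> real \<Rightarrow> 'a" where
  "longitude \<tau> = (\<lambda>s. \<tau> (cis (2 * pi * s), 1))"

text \<open>The three components of the necklace. The second and the third one bound the disjoint discs
  \<open>{(z, w). norm z \<le> 3/5 \<and> w = \<plusminus> sqrt (1 - norm z\<^sup>2)}\<close>, which meet the first one in \<open>(0, \<plusminus>1)\<close>.\<close>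

definition necklace_0 :: "complex \<Rightarrow> complex \<times> complex" where
  "necklace_0 u = (0, u)"

definition necklace_1 :: "complex \<Rightarrow> complex \<times> complex" where
  "necklace_1 u = (3 / 5 * u, 4 / 5)"

definition necklace_2 :: "complex \<Rightarrow> complex \<times> complex" where
  "necklace_2 u = (3 / 5 * u, - 4 / 5)"

text \<open>The right-handed trefoil as the positive torus knot of type (2,3).\<close>

definition trefoil :: "complex \<Rightarrow> complex \<times> complex" where
  "trefoil u = (u ^ 2 / complex_of_real (sqrt 2), u ^ 3 / complex_of_real (sqrt 2))"

text \<open>\<open>M\<close> is the splice of \<open>M'\<close> and \<open>M''\<close> along the knots with standard tubular neighbourhoods
  \<open>\<tau>'\<close> and \<open>\<tau>''\<close>: the pushout, with structure maps \<open>i'\<close> and \<open>i''\<close>, of the two knot exteriors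
  under the identification of the boundary tori that exchanges meridian and longitude.\<close>

definition is_splice ::
    "'b topology \<Rightarrow> (complex \<times> complex \<Rightarrow> 'b) \<Rightarrow> 'c topology \<Rightarrow> (complex \<times> complex \<Rightarrow> 'c) \<Rightarrow>
      'a topology \<Rightarrow> ('b \<Rightarrow> 'a) \<Rightarrow> ('c \<Rightarrow> 'a) \<Rightarrow> bool" where
  "is_splice M' \<tau>' M'' \<tau>'' M i' i'' \<longleftrightarrow>
     (let E' = remove_nbhd M' \<tau>'; E'' = remove_nbhd M'' \<tau>'' in
       inj_on i' (topspace E') \<and> inj_on i'' (topspace E'') \<and>
       i' ` topspace E' \<union> i'' ` topspace E'' = topspace M \<and>
       (\<forall>x \<in> topspace E'. \<forall>y \<in> topspace E''. i' x = i'' y \<longleftrightarrow>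
          (\<exists>u \<in> sphere 0 1. \<exists>v \<in> sphere 0 1. x = \<tau>' (u, v) \<and> y = \<tau>'' (v, u))) \<and>
       (\<forall>U \<subseteq> topspace M. openin M U \<longleftrightarrow>
          openin E' {x \<in> topspace E'. i' x \<in> U} \<and> openin E'' {y \<in> topspace E''. i'' y \<in> U}))"


section \<open>The knot, and the generators of its group\<close>

text \<open>\<open>M\<close> is obtained by splicing the necklace, with neighbourhoods \<open>\<tau>\<^sub>0\<close>, \<open>\<tau>\<^sub>1\<close>, \<open>\<tau>\<^sub>2\<close> of
  its components, with two right-handed trefoils: component 1 with the trefoil with
  neighbourhood \<open>\<tau>\<^sub>L\<close>, which gives \<open>M\<^sub>1\<close>, and then component 0 with the trefoil with
  neighbourhood \<open>\<tau>\<^sub>R\<close>. The longitude of component 0 stays null-homologous in the first splice: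
  it bounds a disc meeting component 1 in one point, and the hole is filled by a Seifert surface.
  The maps \<open>h\<close>, \<open>h\<^sub>L\<close>, \<open>h\<^sub>R\<close> include the exteriors of the necklace and of the trefoils into \<open>M\<close>,
  so the knot \<open>K\<close> in \<open>M\<close> is \<open>h \<circ> necklace_2\<close>, with tubular neighbourhood \<open>h \<circ> \<tau>\<^sub>2\<close>.\<close>

definition spliced_necklace ::
    "(complex \<times> complex \<Rightarrow> complex \<times> complex) \<Rightarrow> (complex \<times> complex \<Rightarrow> complex \<times> complex) \<Rightarrow>
     (complex \<times> complex \<Rightarrow> complex \<times> complex) \<Rightarrow> (complex \<times> complex \<Rightarrow> complex \<times> complex) \<Rightarrow>
     (complex \<times> complex \<Rightarrow> complex \<times> complex) \<Rightarrow> 'b topology \<Rightarrow> 'a topology \<Rightarrow>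
     (complex \<times> complex \<Rightarrow> 'a) \<Rightarrow> (complex \<times> complex \<Rightarrow> 'a) \<Rightarrow> (complex \<times> complex \<Rightarrow> 'a) \<Rightarrow> bool" where
  "spliced_necklace \<tau>\<^sub>0 \<tau>\<^sub>1 \<tau>\<^sub>2 \<tau>\<^sub>L \<tau>\<^sub>R M\<^sub>1 M h h\<^sub>L h\<^sub>R \<longleftrightarrow>
     framed_nbhd necklace_0 \<tau>\<^sub>0 \<and> framed_nbhd necklace_1 \<tau>\<^sub>1 \<and> framed_nbhd necklace_2 \<tau>\<^sub>2 \<and>
     disjnt (closed_nbhd \<tau>\<^sub>0) (closed_nbhd \<tau>\<^sub>1) \<and>
     disjnt (closed_nbhd \<tau>\<^sub>0) (closed_nbhd \<tau>\<^sub>2) \<and>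
     disjnt (closed_nbhd \<tau>\<^sub>1) (closed_nbhd \<tau>\<^sub>2) \<and>
     framed_nbhd trefoil \<tau>\<^sub>L \<and> framed_nbhd trefoil \<tau>\<^sub>R \<and>
     (\<exists>i i\<^sub>L j.
        is_splice (top_of_set three_sphere) \<tau>\<^sub>1 (top_of_set three_sphere) \<tau>\<^sub>L M\<^sub>1 i i\<^sub>L \<and>
        is_splice M\<^sub>1 (i \<circ> \<tau>\<^sub>0) (top_of_set three_sphere) \<tau>\<^sub>R M j h\<^sub>R \<and>
        h = j \<circ> i \<and> h\<^sub>L = j \<circ> i\<^sub>L)"

datatype gen = gx | gy | gn | gs | gt | ga | gb

definition pos :: "gen list \<Rightarrow> (gen \<times> bool) list" where
  "pos w = map (\<lambda>g. (g, True)) w"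

definition longitude_word :: "gen \<Rightarrow> gen \<Rightarrow> (gen \<times> bool) list" where
  "longitude_word x y =
     [(x, False), (y, True), (x, True), (x, True), (y, True), (x, False), (x, False), (x, False)]"

definition knot_relations :: "((gen \<times> bool) list \<times> (gen \<times> bool) list) set" where
  "knot_relations =
     {(pos [gx, gy, gx], pos [gy, gx, gy]),
      (pos [ga, gb, ga], pos [gb, ga, gb]),
      (pos [gn, gs], pos [gs, gn]),
      (pos [gn, gt], pos [gt, gn]),
      (pos [gx], pos [gn]),
      (pos [gs], longitude_word gx gy),
      (pos [gs, gt], pos [ga]),
      (pos [gn], longitude_word ga gb)}"

text \<open>The generators of the group of the exterior of the spliced knot, based at \<open>h q\<close>.
  They are represented by loops \<open>l\<close> in the pieces: those for \<open>n\<close>, \<open>s\<close>, \<open>t\<close> are based at \<open>q\<close>,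
  and those for \<open>x\<close>, \<open>y\<close> and \<open>a\<close>, \<open>b\<close> are based at a point of the boundary torus of the
  respective trefoil exterior, and are joined to \<open>h q\<close> along the arcs \<open>d\<^sub>1\<close> and \<open>d\<^sub>0\<close> in the
  necklace exterior, which also serve to base the meridians and longitudes of components 1 and 0.\<close>

definition standard_generators ::
    "(complex \<times> complex \<Rightarrow> complex \<times> complex) \<Rightarrow> (complex \<times> complex \<Rightarrow> complex \<times> complex) \<Rightarrow>
     (complex \<times> complex \<Rightarrow> complex \<times> complex) \<Rightarrow> (complex \<times> complex \<Rightarrow> complex \<times> complex) \<Rightarrow>
     (complex \<times> complex \<Rightarrow> complex \<times> complex) \<Rightarrow> 'a topology \<Rightarrow>
     (complex \<times> complex \<Rightarrow> 'a) \<Rightarrow> (complex \<times> complex \<Rightarrow> 'a) \<Rightarrow> (complex \<times> complex \<Rightarrow> 'a) \<Rightarrow>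
     complex \<times> complex \<Rightarrow> (gen \<Rightarrow> (real \<Rightarrow> 'a) set) \<Rightarrow> bool" where
  "standard_generators \<tau>\<^sub>0 \<tau>\<^sub>1 \<tau>\<^sub>2 \<tau>\<^sub>L \<tau>\<^sub>R X h h\<^sub>L h\<^sub>R q \<gamma> \<longleftrightarrow>
     (let E = remove_nbhd (remove_nbhd (remove_nbhd (top_of_set three_sphere) \<tau>\<^sub>0) \<tau>\<^sub>1) \<tau>\<^sub>2;
          E\<^sub>L = remove_nbhd (top_of_set three_sphere) \<tau>\<^sub>L;
          E\<^sub>R = remove_nbhd (top_of_set three_sphere) \<tau>\<^sub>R;
          G = fundamental_group E q;
          G\<^sub>L = fundamental_group E\<^sub>L (\<tau>\<^sub>L (1, 1));
          G\<^sub>R = fundamental_group E\<^sub>R (\<tau>\<^sub>R (1, 1)) in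
      \<exists>l d\<^sub>0 d\<^sub>1 d\<^sub>2.
        path_from_to E q (\<tau>\<^sub>0 (1, 1)) d\<^sub>0 \<and>
        path_from_to E q (\<tau>\<^sub>1 (1, 1)) d\<^sub>1 \<and>
        path_from_to E q (\<tau>\<^sub>2 (1, 1)) d\<^sub>2 \<and>
        (\<forall>g \<in> {gn, gs, gt}. path_from_to E q q (l g)) \<and>
        (\<forall>g \<in> {gx, gy}. path_from_to E\<^sub>L (\<tau>\<^sub>L (1, 1)) (\<tau>\<^sub>L (1, 1)) (l g)) \<and>
        (\<forall>g \<in> {ga, gb}. path_from_to E\<^sub>R (\<tau>\<^sub>R (1, 1)) (\<tau>\<^sub>R (1, 1)) (l g)) \<and>
        has_presentation G {gn, gs, gt} (path_class E \<circ> l)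
          {(pos [gn, gs], pos [gs, gn]), (pos [gn, gt], pos [gt, gn])} \<and>
        path_class E (l gn) = based_class E d\<^sub>0 (meridian \<tau>\<^sub>0) \<and>
        path_class E (l gs) = based_class E d\<^sub>1 (meridian \<tau>\<^sub>1) \<and>
        path_class E (l gt) = based_class E d\<^sub>2 (meridian \<tau>\<^sub>2) \<and>
        word_value G (path_class E \<circ> l) (pos [gs, gt]) = based_class E d\<^sub>0 (longitude \<tau>\<^sub>0) \<and>
        path_class E (l gn) = based_class E d\<^sub>1 (longitude \<tau>\<^sub>1) \<and>
        has_presentation G\<^sub>L {gx, gy} (path_class E\<^sub>L \<circ> l) {(pos [gx, gy, gx], pos [gy, gx, gy])} \<and>
        path_class E\<^sub>L (l gx) = path_class E\<^sub>L (meridian \<tau>\<^sub>L) \<and>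
        word_value G\<^sub>L (path_class E\<^sub>L \<circ> l) (longitude_word gx gy) = path_class E\<^sub>L (longitude \<tau>\<^sub>L) \<and>
        has_presentation G\<^sub>R {ga, gb} (path_class E\<^sub>R \<circ> l) {(pos [ga, gb, ga], pos [gb, ga, gb])} \<and>
        path_class E\<^sub>R (l ga) = path_class E\<^sub>R (meridian \<tau>\<^sub>R) \<and>
        word_value G\<^sub>R (path_class E\<^sub>R \<circ> l) (longitude_word ga gb) = path_class E\<^sub>R (longitude \<tau>\<^sub>R) \<and>
        (\<forall>g \<in> {gn, gs, gt}. \<gamma> g = path_class X (h \<circ> l g)) \<and>
        (\<forall>g \<in> {gx, gy}. \<gamma> g = based_class X (h \<circ> d\<^sub>1) (h\<^sub>L \<circ> l g)) \<and>
        (\<forall>g \<in> {ga, gb}. \<gamma> g = based_class X (h \<circ> d\<^sub>0) (h\<^sub>R \<circ> l g)))"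

end

theory Submission
  imports Defs "HOL-Computational_Algebra.Polynomial_Factorial"
begin

text \<open>Every order of the twisted homology is divisible by 3. On \<open>{2, 4}\<close> both \<open>\<alpha>(x)\<close> and \<open>\<alpha>(y)\<close> act
  as the transposition, and the double cover of the left trefoil exterior has 3-torsion in its first
  homology. Accordingly there is a crossed homomorphism modulo 3 from the knot group to the dual of
  \<open>\<int>\<^sup>5 \<otimes> \<int>[t\<^sup>\<plusminus>\<^sup>1]\<close> that sends \<open>y\<close> to \<open>e\<^sub>2 - e\<^sub>4\<close> and all other generators to 0: only the relation
  \<open>xyx = yxy\<close> needs the modulus. It turns into a functional on the twisted 1-chains that vanishes
  modulo 3 on the boundaries but takes the value \<open>-1\<close> on the cycle \<open>(y - x) \<otimes> e\<^sub>4\<close>. Multiplying by the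
  adjugate matrix, one sees that 3 divides the determinant of every square matrix of relations, so
  3 divides every order. Orders exist because \<open>\<int>[t\<^sup>\<plusminus>\<^sup>1]\<close> inherits greatest common divisors
  from \<open>\<int>[t]\<close>.\<close>

section \<open>Path classes\<close>

abbreviation unit_interval :: "real topology" where
  "unit_interval \<equiv> top_of_set {0..1}"

lemma homotopic_paths_cong:
  assumes "pathin X c" "\<And>s. s \<in> {0..1} \<Longrightarrow> c s = d s"
  shows "homotopic_with (\<lambda>h. h 0 = c 0 \<and> h 1 = c 1) unit_interval X c d"
  using assms by (intro homotopic_with_equal) (auto simp: pathin_def)

lemma path_class_eqI:
  assumes "homotopic_with (\<lambda>h. h 0 = c 0 \<and> h 1 = c 1) unit_interval X c d"
  shows "path_class X c = path_class X d"
proof -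
  have "d 0 = c 0" "d 1 = c 1"
    using homotopic_with_imp_property[OF assms] by auto
  then show ?thesis
    using assms unfolding path_class_def
    by (auto intro: homotopic_with_trans homotopic_with_symD)
qed

text \<open>Paths are total functions on the reals, but continuity and endpoints concern only
  \<open>{0..1}\<close>; values outside are immaterial to the class.\<close>

lemma path_class_cong:
  assumes "pathin X c" "\<And>s. s \<in> {0..1} \<Longrightarrow> c s = d s"
  shows "path_class X c = path_class X d"
  by (intro path_class_eqI homotopic_paths_cong assms)

lemma mem_path_class_self: "pathin X c \<Longrightarrow> c \<in> path_class X c"
  by (simp add: path_class_def pathin_def)

lemma pathin_path_join:
  assumes c: "pathin X c" and d: "pathin X d" and cd: "c 1 = d 0"
  shows "pathin X (path_join c d)"
  unfolding pathin_def path_join_def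
proof (rule continuous_map_cases_le)
  have "{0..1} \<inter> {s \<in> topspace unit_interval. s \<le> 1/2} = {0..1/2}"
    "{0..1} \<inter> {s \<in> topspace unit_interval. 1/2 \<le> s} = {1/2..1}" by auto
  then have eq: "subtopology unit_interval {s \<in> topspace unit_interval. s \<le> 1/2} = top_of_set {0..1/2}"
    "subtopology unit_interval {s \<in> topspace unit_interval. 1/2 \<le> s} = top_of_set {1/2..1}"
    by (simp_all add: subtopology_subtopology)
  have "continuous_map (top_of_set {0..1/2}) unit_interval (\<lambda>s. 2 * s)"
    "continuous_map (top_of_set {1/2..1}) unit_interval (\<lambda>s. 2 * s - 1)"
    by (auto simp: continuous_map_in_subtopology intro!: continuous_on_mult continuous_on_diff continuous_on_const continuous_on_id)
  from continuous_map_compose[OF this(1) c[unfolded pathin_def]] continuous_map_compose[OF this(2) d[unfolded pathin_def]]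
  show "continuous_map (subtopology unit_interval {s \<in> topspace unit_interval. s \<le> 1/2}) X (\<lambda>s. c (2 * s))"
    "continuous_map (subtopology unit_interval {s \<in> topspace unit_interval. 1/2 \<le> s}) X (\<lambda>s. d (2 * s - 1))"
    unfolding eq by (simp_all add: o_def)
next
  fix s :: real assume s: "s = 1/2"
  show "c (2 * s) = d (2 * s - 1)" unfolding s using cd by simp
qed simp_all

lemma pathin_path_reverse:
  assumes "pathin X c"
  shows "pathin X (path_reverse c)"
proof -
  have "continuous_map unit_interval unit_interval (\<lambda>s. 1 - s)"
    by (auto simp: continuous_map_in_subtopology intro!: continuous_on_diff continuous_on_const continuous_on_id)
  from continuous_map_compose[OF this assms[unfolded pathin_def]] show ?thesis
    by (simp add: pathin_def path_reverse_def o_def)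
qed

lemma path_join_ends [simp]: "path_join c d 0 = c 0" "path_join c d 1 = d 1"
  by (simp_all add: path_join_def)

text \<open>The two homotopies are placed side by side in the path parameter. Both fix endpoints, so
  they agree along the seam.\<close>

lemma homotopic_path_join:
  assumes c: "homotopic_with (\<lambda>h. h 0 = c 0 \<and> h 1 = c 1) unit_interval X c c'"
    and d: "homotopic_with (\<lambda>h. h 0 = d 0 \<and> h 1 = d 1) unit_interval X d d'"
    and cd: "c 1 = d 0"
  shows "homotopic_with (\<lambda>h. h 0 = c 0 \<and> h 1 = d 1) unit_interval X (path_join c d) (path_join c' d')"
proof -
  let ?I2 = "prod_topology unit_interval unit_interval"
  obtain h where h: "continuous_map ?I2 X h" "\<And>s. h (0, s) = c s" "\<And>s. h (1, s) = c' s"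
      "\<And>t. t \<in> {0..1} \<Longrightarrow> h (t, 0) = c 0 \<and> h (t, 1) = c 1"
    using c by (auto simp: homotopic_with_def)
  obtain k where k: "continuous_map ?I2 X k" "\<And>s. k (0, s) = d s" "\<And>s. k (1, s) = d' s"
      "\<And>t. t \<in> {0..1} \<Longrightarrow> k (t, 0) = d 0 \<and> k (t, 1) = d 1"
    using d by (auto simp: homotopic_with_def)
  let ?H = "\<lambda>z. if snd z \<le> 1/2 then h (fst z, 2 * snd z) else k (fst z, 2 * snd z - 1)"
  have I2: "?I2 = top_of_set ({0..1} \<times> {0..1})"
    by (simp flip: subtopology_Times)
  have "continuous_map ?I2 X ?H"
  proof (rule continuous_map_cases_le)
    show "continuous_map ?I2 euclideanreal snd"
      unfolding I2 by (simp add: continuous_on_snd continuous_on_id)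
    have "({0..1} \<times> {0..1}) \<inter> {z \<in> topspace ?I2. snd z \<le> 1/2} = {0..1} \<times> {0..1/2}"
      "({0..1} \<times> {0..1}) \<inter> {z \<in> topspace ?I2. 1/2 \<le> snd z} = {0..1} \<times> {1/2..1}" by auto
    then have eq: "subtopology ?I2 {z \<in> topspace ?I2. snd z \<le> 1/2} = top_of_set ({0..1} \<times> {0..1/2})"
      "subtopology ?I2 {z \<in> topspace ?I2. 1/2 \<le> snd z} = top_of_set ({0..1} \<times> {1/2..1})"
      unfolding I2 by (simp_all add: subtopology_subtopology)
    have "continuous_map (top_of_set ({0..1} \<times> {0..1/2})) ?I2 (\<lambda>z. (fst z, 2 * snd z))"
      "continuous_map (top_of_set ({0..1} \<times> {1/2..1})) ?I2 (\<lambda>z. (fst z, 2 * snd z - 1))"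
      unfolding I2 by (auto simp: continuous_map_in_subtopology intro!: continuous_on_Pair continuous_on_mult
          continuous_on_diff continuous_on_const continuous_on_id continuous_on_fst continuous_on_snd)
    from continuous_map_compose[OF this(1) h(1)] continuous_map_compose[OF this(2) k(1)]
    show "continuous_map (subtopology ?I2 {z \<in> topspace ?I2. snd z \<le> 1/2}) X (\<lambda>z. h (fst z, 2 * snd z))"
      "continuous_map (subtopology ?I2 {z \<in> topspace ?I2. 1/2 \<le> snd z}) X (\<lambda>z. k (fst z, 2 * snd z - 1))"
      unfolding eq by (simp_all add: o_def)
  next
    fix z assume "z \<in> topspace ?I2" and z: "snd z = 1/2"
    then have "fst z \<in> {0..1}" by auto
    then have "h (fst z, 1) = k (fst z, 0)" using h(4) k(4) cd by metis
    then show "h (fst z, 2 * snd z) = k (fst z, 2 * snd z - 1)" unfolding z by simp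
  qed simp_all
  then show ?thesis
    unfolding homotopic_with_def
    by (intro exI[of _ ?H]) (use h k in \<open>auto simp: path_join_def\<close>)
qed

text \<open>\<open>class_mult\<close> is a union over all representatives; concatenation respects
  homotopy, so every member of the union is the same class.\<close>

lemma class_mult_path_class:
  assumes c: "pathin X c" and d: "pathin X d" and cd: "c 1 = d 0"
  shows "class_mult X (path_class X c) (path_class X d) = path_class X (path_join c d)"
proof -
  have "path_class X (path_join c' d') = path_class X (path_join c d)"
    if "c' \<in> path_class X c" "d' \<in> path_class X d" for c' d'
    using homotopic_path_join[of c X c' d d'] that cd
    by (intro path_class_eqI[symmetric]) (simp add: path_class_def)
  then show ?thesis
    using mem_path_class_self[OF c] mem_path_class_self[OF d] unfolding class_mult_def by blast
qed

text \<open>The straight-line homotopy stays in the convex set \<open>K\<close> and is pushed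
  forward along \<open>\<sigma>\<close>. With \<open>K\<close> an interval this handles
  reparametrisations, with \<open>K\<close> a standard simplex it compares edge paths.\<close>

lemma homotopic_in_convex:
  fixes f g :: "real \<Rightarrow> 'i \<Rightarrow> real"
  assumes f: "pathin (powertop_real UNIV) f" "f ` {0..1} \<subseteq> K"
    and g: "pathin (powertop_real UNIV) g" "g ` {0..1} \<subseteq> K"
    and ends: "f 0 = g 0" "f 1 = g 1"
    and K: "\<And>x y t. x \<in> K \<Longrightarrow> y \<in> K \<Longrightarrow> t \<in> {0..1} \<Longrightarrow> (\<lambda>i. (1 - t) * x i + t * y i) \<in> K"
    and \<sigma>: "continuous_map (subtopology (powertop_real UNIV) K) X \<sigma>"
  shows "path_class X (\<sigma> \<circ> f) = path_class X (\<sigma> \<circ> g)"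
proof (rule path_class_eqI)
  let ?I2 = "prod_topology unit_interval unit_interval"
  let ?H = "\<lambda>(t, s) i. (1 - t) * f s i + t * g s i"
  have proj: "continuous_map unit_interval euclideanreal (\<lambda>s. p s i)"
    if "pathin (powertop_real UNIV) p" for p :: "real \<Rightarrow> 'i \<Rightarrow> real" and i
    using that by (simp add: pathin_def continuous_map_componentwise_UNIV)
  have comp: "continuous_map ?I2 euclideanreal (\<lambda>z. p (snd z) i)"
    if "pathin (powertop_real UNIV) p" for p :: "real \<Rightarrow> 'i \<Rightarrow> real" and i
    using continuous_map_compose[OF continuous_map_snd[of unit_interval unit_interval] proj[OF that]] by (simp add: o_def)
  have "continuous_map ?I2 euclideanreal fst"
    using continuous_map_fst continuous_map_in_subtopology by blast
  then have cont: "continuous_map ?I2 euclideanreal (\<lambda>z. (1 - fst z) * f (snd z) i + fst z * g (snd z) i)" for i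
    using comp[OF f(1), of i] comp[OF g(1), of i]
    by (intro continuous_map_add continuous_map_real_mult continuous_map_diff continuous_map_const[THEN iffD2]) auto
  have "?H z \<in> K" if "z \<in> topspace ?I2" for z
  proof -
    have "f (snd z) \<in> K" "g (snd z) \<in> K" "fst z \<in> {0..1}"
      using that f(2) g(2) by auto
    from K[OF this] show ?thesis by (simp add: case_prod_unfold)
  qed
  then have "continuous_map ?I2 (subtopology (powertop_real UNIV) K) ?H"
    using cont by (auto simp: continuous_map_in_subtopology continuous_map_componentwise_UNIV case_prod_unfold)
  then have "homotopic_with (\<lambda>h. h 0 = f 0 \<and> h 1 = f 1) unit_interval (subtopology (powertop_real UNIV) K) f g"
    unfolding homotopic_with_def
    by (intro exI[of _ ?H]) (auto simp: ends algebra_simps)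
  then show "homotopic_with (\<lambda>h. h 0 = (\<sigma> \<circ> f) 0 \<and> h 1 = (\<sigma> \<circ> f) 1) unit_interval X (\<sigma> \<circ> f) (\<sigma> \<circ> g)"
    by (rule homotopic_with_compose_continuous_map_left) (use \<sigma> in auto)
qed

section \<open>Line segments, reparametrisation and associativity of path classes\<close>

definition lin_seg :: "('i \<Rightarrow> real) \<Rightarrow> ('i \<Rightarrow> real) \<Rightarrow> real \<Rightarrow> 'i \<Rightarrow> real" where
  "lin_seg u v = (\<lambda>s i. (1 - s) * u i + s * v i)"

lemma lin_seg_ends [simp]: "lin_seg u v 0 = u" "lin_seg u v 1 = v"
  by (simp_all add: lin_seg_def)

lemma pathin_lin_seg: "pathin (powertop_real UNIV) (lin_seg u v)"
  by (auto simp: pathin_def continuous_map_componentwise_UNIV lin_seg_def intro!: continuous_on_add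
    continuous_on_mult continuous_on_diff continuous_on_const continuous_on_id)

text \<open>Both bracketings run through the same path at different speeds, and reparametrisations
  with the same endpoints are homotopic inside the interval.\<close>

lemma path_class_mult_assoc:
  assumes a: "path_from_to X p q a" and b: "path_from_to X q r b" and c: "path_from_to X r s c"
  shows "class_mult X (class_mult X (path_class X a) (path_class X b)) (path_class X c)
    = class_mult X (path_class X a) (class_mult X (path_class X b) (path_class X c))"
proof -
  \<comment> \<open>\<open>J\<close> carries the breaks 1/4 and 1/2 of
    \<open>path_join (path_join a b) c\<close> to the breaks 1/2 and 3/4 of \<open>m\<close>. The
    index type \<open>unit\<close> presents the interval as a convex set of real functions, as
    \<open>homotopic_in_convex\<close> requires.\<close>
  define J :: "real \<Rightarrow> unit \<Rightarrow> real"
    where "J = path_join (path_join (lin_seg (\<lambda>_. 0) (\<lambda>_. 1/2)) (lin_seg (\<lambda>_. 1/2) (\<lambda>_. 3/4))) (lin_seg (\<lambda>_. 3/4) (\<lambda>_. 1))"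
  define L :: "real \<Rightarrow> unit \<Rightarrow> real" where "L = lin_seg (\<lambda>_. 0) (\<lambda>_. 1)"
  define m where "m = path_join a (path_join b c)"
  have m: "pathin X m"
    using a b c unfolding m_def path_from_to_def by (auto intro!: pathin_path_join)
  let ?K = "{x :: unit \<Rightarrow> real. x () \<in> {0..1}}"
  have mu: "continuous_map (subtopology (powertop_real UNIV) ?K) X (\<lambda>x. m (x ()))"
  proof -
    have "continuous_map (subtopology (powertop_real UNIV) ?K) unit_interval (\<lambda>x. x ())"
      by (auto simp: continuous_map_in_subtopology intro!: continuous_map_from_subtopology continuous_map_product_projection)
    from continuous_map_compose[OF this m[unfolded pathin_def]] show ?thesis by (simp add: o_def)
  qed
  have "path_class X ((\<lambda>x. m (x ())) \<circ> J) = path_class X ((\<lambda>x. m (x ())) \<circ> L)"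
  proof (rule homotopic_in_convex[OF _ _ _ _ _ _ _ mu])
    show "pathin (powertop_real UNIV) J" unfolding J_def
      by (intro pathin_path_join pathin_lin_seg) auto
    show "J ` {0..1} \<subseteq> ?K" unfolding J_def path_join_def lin_seg_def by (auto simp: field_simps)
    show "pathin (powertop_real UNIV) L" unfolding L_def by (rule pathin_lin_seg)
    show "L ` {0..1} \<subseteq> ?K" unfolding L_def lin_seg_def by auto
    show "(\<lambda>i. (1 - t) * x i + t * y i) \<in> ?K" if "x \<in> ?K" "y \<in> ?K" "t \<in> {0..1}" for x y t
      using that convex_bound_le[of "x ()" 1 "y ()" "1 - t" t] by auto
  qed (auto simp: J_def L_def)
  moreover have "(\<lambda>x. m (x ())) \<circ> L = m"
    by (auto simp: L_def lin_seg_def)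
  moreover have "path_class X ((\<lambda>x. m (x ())) \<circ> J) = path_class X (path_join (path_join a b) c)"
  proof (rule path_class_cong[symmetric])
    show "pathin X (path_join (path_join a b) c)"
      using a b c unfolding path_from_to_def by (auto intro!: pathin_path_join)
    show "path_join (path_join a b) c s = ((\<lambda>x. m (x ())) \<circ> J) s" if "s \<in> {0..1}" for s
    proof -
      have "J s () = (if s \<le> 1/4 then 2 * s else if s \<le> 1/2 then s + 1/4 else (s + 1) / 2)"
        by (simp add: J_def path_join_def lin_seg_def field_simps)
      then show ?thesis
        by (simp add: m_def path_join_def field_simps) (simp add: diff_divide_distrib mult.commute)
    qed
  qed
  ultimately show ?thesis
    using a b c by (simp add: class_mult_path_class pathin_path_join path_from_to_def m_def)
qed

section \<open>Edges of singular simplices\<close>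

lemma vertex_in_standard_simplex: "i \<le> k \<Longrightarrow> vertex i \<in> standard_simplex k"
  by (auto simp: vertex_def standard_simplex_def)

lemma standard_simplex_convex:
  assumes "x \<in> standard_simplex k" "y \<in> standard_simplex k" "t \<in> {0..1}"
  shows "(\<lambda>i. (1 - t) * x i + t * y i) \<in> standard_simplex k"
  using assms convex_bound_le[of _ 1 _ "1 - t" t]
  by (auto simp: standard_simplex_def sum.distrib simp flip: sum_distrib_left)

lemma lin_seg_in_standard_simplex:
  assumes "i \<le> k" "j \<le> k" "s \<in> {0..1}"
  shows "lin_seg (vertex i) (vertex j) s \<in> standard_simplex k"
  unfolding lin_seg_def by (intro standard_simplex_convex vertex_in_standard_simplex assms)

lemma path_from_to_simplex_edge:
  assumes "singular_simplex k X \<sigma>" "i \<le> k" "j \<le> k"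
  shows "path_from_to X (\<sigma> (vertex i)) (\<sigma> (vertex j)) (\<sigma> \<circ> lin_seg (vertex i) (vertex j))"
proof -
  have "continuous_map unit_interval (subtopology (powertop_real UNIV) (standard_simplex k)) (lin_seg (vertex i) (vertex j))"
    using pathin_lin_seg[of "vertex i" "vertex j"] lin_seg_in_standard_simplex[OF assms(2,3)]
    by (auto simp: pathin_def continuous_map_in_subtopology)
  with assms(1) show ?thesis
    by (auto simp: path_from_to_def pathin_def singular_simplex_def intro: continuous_map_compose)
qed

lemma first_edge_eq: "first_edge \<sigma> = \<sigma> \<circ> lin_seg (vertex 0) (vertex 1)"
  by (simp add: first_edge_def lin_seg_def o_def)

text \<open>The broken path 0-1-2 and the straight edge 0-2 have the same endpoints in a convex
  simplex.\<close>

lemma simplex_edges_homotopic: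
  assumes "singular_simplex 2 X \<sigma>"
  shows "class_mult X (path_class X (\<sigma> \<circ> lin_seg (vertex 0) (vertex 1))) (path_class X (\<sigma> \<circ> lin_seg (vertex 1) (vertex 2)))
    = path_class X (\<sigma> \<circ> lin_seg (vertex 0) (vertex 2))"
proof -
  let ?J = "path_join (lin_seg (vertex 0) (vertex 1)) (lin_seg (vertex 1) (vertex 2))"
  note edge = path_from_to_simplex_edge[OF assms, unfolded path_from_to_def]
  have "path_class X (\<sigma> \<circ> ?J) = path_class X (\<sigma> \<circ> lin_seg (vertex 0) (vertex 2))"
  proof (rule homotopic_in_convex[where K = "standard_simplex 2"])
    show "continuous_map (subtopology (powertop_real UNIV) (standard_simplex 2)) X \<sigma>"
      using assms by (simp add: singular_simplex_def)
    show "?J ` {0..1} \<subseteq> standard_simplex 2"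
      by (auto simp: path_join_def intro!: lin_seg_in_standard_simplex)
    show "lin_seg (vertex 0) (vertex 2) ` {0..1} \<subseteq> standard_simplex 2"
      by (auto intro!: lin_seg_in_standard_simplex)
  qed (auto intro: pathin_path_join pathin_lin_seg standard_simplex_convex)
  moreover have "\<sigma> \<circ> ?J = path_join (\<sigma> \<circ> lin_seg (vertex 0) (vertex 1)) (\<sigma> \<circ> lin_seg (vertex 1) (vertex 2))"
    by (auto simp: path_join_def)
  moreover have "class_mult X (path_class X (\<sigma> \<circ> lin_seg (vertex 0) (vertex 1))) (path_class X (\<sigma> \<circ> lin_seg (vertex 1) (vertex 2)))
    = path_class X (path_join (\<sigma> \<circ> lin_seg (vertex 0) (vertex 1)) (\<sigma> \<circ> lin_seg (vertex 1) (vertex 2)))"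
    using edge[of 0 1] edge[of 1 2] by (intro class_mult_path_class) auto
  ultimately show ?thesis by simp
qed

section \<open>Composition and reversal of path classes; faces of lifted simplices\<close>

lemma class_mult_in_path_classes:
  assumes "c \<in> path_classes X p q" "d \<in> path_classes X q r"
  shows "class_mult X c d \<in> path_classes X p r"
proof -
  from assms obtain a b where "c = path_class X a" "path_from_to X p q a"
    "d = path_class X b" "path_from_to X q r b"
    by (auto simp: path_classes_def)
  then show ?thesis
    using class_mult_path_class[of X a b]
    by (auto simp: path_classes_def path_from_to_def intro!: exI[of _ "path_join a b"] pathin_path_join)
qed

lemma class_mult_assoc:
  assumes "c \<in> path_classes X p q" "d \<in> path_classes X q r" "e \<in> path_classes X r s"
  shows "class_mult X (class_mult X c d) e = class_mult X c (class_mult X d e)"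
proof -
  from assms obtain a b f where "c = path_class X a" "path_from_to X p q a"
    "d = path_class X b" "path_from_to X q r b" "e = path_class X f" "path_from_to X r s f"
    unfolding path_classes_def by blast
  then show ?thesis using path_class_mult_assoc[of X p q a r b s f] by simp
qed

text \<open>Supplies the return paths that close up a class ending at an arbitrary point.\<close>

lemma path_classes_reverse:
  assumes "c \<in> path_classes X p q"
  shows "path_classes X q p \<noteq> {}"
proof -
  from assms obtain a where "path_from_to X p q a" by (auto simp: path_classes_def)
  then have "path_from_to X q p (path_reverse a)"
    using pathin_path_reverse[of X a] by (auto simp: path_from_to_def path_reverse_def)
  then show ?thesis by (auto simp: path_classes_def)
qed

text \<open>The face map inserts a zero coordinate at position \<open>m\<close>, so the vertices
  from \<open>m\<close> on shift by one.\<close>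

lemma singular_face_vertex:
  assumes "i \<le> k" "m \<le> Suc k"
  shows "singular_face (Suc k) m \<sigma> (vertex i) = \<sigma> (vertex (if i < m then i else Suc i))"
proof -
  have "simplical_face m (vertex i) = vertex (if i < m then i else Suc i)"
    by (auto simp: simplical_face_def vertex_def fun_eq_iff)
  then show ?thesis
    using vertex_in_standard_simplex[OF assms(1)] by (simp add: singular_face_def)
qed

text \<open>A face is restricted to its standard simplex, so its first edge is compared with an edge
  of \<open>\<sigma>\<close> over the unit interval only; hence an equality of classes.\<close>

lemma singular_face_edge:
  assumes "singular_simplex 2 X \<sigma>" "m \<le> 2"
  shows "path_class X (first_edge (singular_face 2 m \<sigma>))
    = path_class X (\<sigma> \<circ> lin_seg (vertex (if 0 < m then 0 else 1)) (vertex (if 1 < m then 1 else 2)))"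
proof (rule path_class_cong[symmetric])
  show "pathin X (\<sigma> \<circ> lin_seg (vertex (if 0 < m then 0 else 1)) (vertex (if 1 < m then 1 else 2)))"
    using path_from_to_simplex_edge[OF assms(1)] by (simp add: path_from_to_def)
  fix s :: real assume "s \<in> {0..1}"
  then have "lin_seg (vertex 0) (vertex 1) s \<in> standard_simplex 1"
    by (intro lin_seg_in_standard_simplex) auto
  moreover have "simplical_face m (lin_seg (vertex 0) (vertex 1) s)
    = lin_seg (vertex (if 0 < m then 0 else 1)) (vertex (if 1 < m then 1 else 2)) s"
    using assms(2) by (auto simp: simplical_face_def vertex_def lin_seg_def fun_eq_iff)
  ultimately show "(\<sigma> \<circ> lin_seg (vertex (if 0 < m then 0 else 1)) (vertex (if 1 < m then 1 else 2))) s
    = first_edge (singular_face 2 m \<sigma>) s"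
    by (simp add: first_edge_eq singular_face_def)
qed

section \<open>Greatest common divisors of Laurent polynomials\<close>

definition laurent_of_poly :: "int poly \<Rightarrow> laurent" where
  "laurent_of_poly p = (\<Sum>i\<le>Polynomial.degree p. Poly_Mapping.single (int i) (coeff p i))"

lemma lookup_laurent_of_poly:
  "Poly_Mapping.lookup (laurent_of_poly p) k = (if k < 0 then 0 else coeff p (nat k))"
proof -
  have "Poly_Mapping.lookup (laurent_of_poly p) k
    = (\<Sum>i\<le>Polynomial.degree p. if i = nat k \<and> 0 \<le> k then coeff p i else 0)"
    unfolding laurent_of_poly_def lookup_sum lookup_single by (intro sum.cong) (auto simp: when_def)
  also have "\<dots> = (if k < 0 then 0 else coeff p (nat k))"
    by (cases "0 \<le> k") (auto simp: coeff_eq_0)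
  finally show ?thesis .
qed

lemma t_pow_add: "t_pow (i + j) = t_pow i * t_pow j"
  by (simp add: t_pow_def mult_single)

lemma t_pow_0 [simp]: "t_pow 0 = 1"
  by (simp add: t_pow_def)

lemma t_pow_minus_cancel [simp]: "t_pow (- i) * t_pow i = 1" "t_pow i * t_pow (- i) = 1"
  "t_pow i * (t_pow (- i) * f) = f" "t_pow (- i) * (t_pow i * f) = f"
  by (simp_all flip: t_pow_add mult.assoc)

lemma lookup_t_pow_mult: "Poly_Mapping.lookup (t_pow i * f) k = Poly_Mapping.lookup f (k - i)"
\<comment> \<open>Elements of \<open>laurent\<close> also form the free abelian group on the
  exponents, so induction over monomials and differences applies.\<close>
proof (induction f rule: frag_induction[OF subset_UNIV])
  case (2 j)
  then show ?case by (auto simp: t_pow_def mult_single lookup_single when_def)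
next
  case (3 f g)
  then show ?case by (simp add: right_diff_distrib lookup_minus)
qed simp

lemma laurent_of_poly_0 [simp]: "laurent_of_poly 0 = 0"
  by (simp add: laurent_of_poly_def)

lemma laurent_of_poly_add: "laurent_of_poly (p + q) = laurent_of_poly p + laurent_of_poly q"
  by (rule poly_mapping_eqI) (simp add: lookup_laurent_of_poly lookup_add)

lemma laurent_of_poly_pCons:
  "laurent_of_poly (pCons a p) = Poly_Mapping.single 0 a + t_pow 1 * laurent_of_poly p"
proof (rule poly_mapping_eqI)
  fix k :: int
  show "Poly_Mapping.lookup (laurent_of_poly (pCons a p)) k
    = Poly_Mapping.lookup (Poly_Mapping.single 0 a + t_pow 1 * laurent_of_poly p) k"
    by (cases "nat k") (auto simp: lookup_laurent_of_poly lookup_add lookup_t_pow_mult lookup_single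
        when_def coeff_pCons nat_diff_distrib split: nat.splits)
qed

lemma laurent_of_poly_smult: "laurent_of_poly (smult a p) = Poly_Mapping.single 0 a * laurent_of_poly p"
  by (rule poly_mapping_eqI)
    (simp add: lookup_laurent_of_poly Poly_Mapping.map.rep_eq when_def flip: mult_map_scale_conv_mult)

lemma laurent_of_poly_mult: "laurent_of_poly (p * q) = laurent_of_poly p * laurent_of_poly q"
  by (induction p) (simp_all add: laurent_of_poly_add laurent_of_poly_smult laurent_of_poly_pCons algebra_simps)

lemma laurent_of_poly_inj: "laurent_of_poly p = laurent_of_poly q \<Longrightarrow> p = q"
proof (rule poly_eqI)
  fix n assume "laurent_of_poly p = laurent_of_poly q"
  then have "Poly_Mapping.lookup (laurent_of_poly p) (int n) = Poly_Mapping.lookup (laurent_of_poly q) (int n)"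
    by simp
  then show "coeff p n = coeff q n" by (simp add: lookup_laurent_of_poly)
qed

lemma laurent_of_poly_monom: "laurent_of_poly (monom 1 n) = t_pow (int n)"
  by (rule poly_mapping_eqI) (auto simp: lookup_laurent_of_poly t_pow_def lookup_single when_def coeff_monom)

text \<open>Factoring out the lowest power of \<open>t\<close> leaves a polynomial with nonzero
  constant coefficient, the normal form in which divisibility can be compared with that in
  \<int>[t].\<close>

lemma laurent_as_poly: "\<exists>k p. f = t_pow k * laurent_of_poly p \<and> (f \<noteq> 0 \<longrightarrow> coeff p 0 \<noteq> 0)"
proof (cases "f = 0")
  case True
  then show ?thesis by (intro exI[of _ 0]) simp
next
  case False
  let ?K = "Poly_Mapping.keys f"
  define m where "m = Min ?K"
  have K: "finite ?K" "?K \<noteq> {}" using False by auto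
  have m: "m \<in> ?K" "\<And>k. k \<in> ?K \<Longrightarrow> m \<le> k" using K by (auto simp: m_def)
  define p where "p = Abs_poly (\<lambda>n. Poly_Mapping.lookup f (int n + m))"
  have "coeff p = (\<lambda>n. Poly_Mapping.lookup f (int n + m))"
    unfolding p_def
  proof (rule coeff_Abs_poly)
    fix i assume "nat (Max ?K - m) < i"
    then have "Max ?K < int i + m" by linarith
    then have "int i + m \<notin> ?K" using K Max_ge leD by blast
    then show "Poly_Mapping.lookup f (int i + m) = 0" by (simp add: in_keys_iff)
  qed
  moreover have "Poly_Mapping.lookup f k = 0" if "k < m" for k
    using that m(2)[of k] by (auto simp: in_keys_iff)
  ultimately have "f = t_pow m * laurent_of_poly p"
    by (intro poly_mapping_eqI) (simp add: lookup_t_pow_mult lookup_laurent_of_poly)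
  moreover have "coeff p 0 \<noteq> 0"
    using m(1) \<open>coeff p = _\<close> by (simp add: in_keys_iff)
  ultimately show ?thesis by blast
qed

text \<open>The indeterminate is prime and does not divide \<open>p\<close>: a vanishing constant
  coefficient of the product forces that of the cofactor to vanish, and one factor cancels.\<close>

lemma dvd_monom_mult_cancel:
  fixes p q :: "int poly"
  assumes "coeff p 0 \<noteq> 0" "p dvd monom 1 n * q"
  shows "p dvd q"
  using assms(2)
proof (induction n)
  case (Suc n)
  then obtain r where r: "monom 1 (Suc n) * q = p * r" by (auto elim: dvdE)
  have mon: "monom 1 (Suc n) * q = pCons 0 (monom 1 n * q)" by (simp add: monom_Suc)
  then have "coeff p 0 * coeff r 0 = 0" using r by (metis coeff_pCons_0 coeff_mult_0)
  then obtain r' where "r = pCons 0 r'" using assms(1) by (cases r) auto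
  then have "monom 1 n * q = p * r'" using r mon by simp
  then show ?case using Suc.IH by simp
qed simp

lemma t_pow_dvd_iff: "t_pow k * f dvd g \<longleftrightarrow> f dvd g" "f dvd t_pow k * g \<longleftrightarrow> f dvd g"
proof -
  have "t_pow k dvd 1" by (metis dvdI t_pow_minus_cancel(2))
  then show "t_pow k * f dvd g \<longleftrightarrow> f dvd g" "f dvd t_pow k * g \<longleftrightarrow> f dvd g"
    using mult_dvd_mono dvd_mult_unit_iff
    by (metis dvd_mult_left dvd_mult_right dvd_trans dvd_triv_right mult.commute mult.left_neutral mult_dvd_mono dvd_refl)+
qed

text \<open>A Laurent quotient may contain a negative power of \<open>t\<close>. Clearing it leaves
  a monomial factor, which cancels because the constant coefficient of \<open>p\<close> is
  nonzero.\<close>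

lemma laurent_of_poly_dvd_iff:
  assumes "coeff p 0 \<noteq> 0"
  shows "laurent_of_poly p dvd laurent_of_poly q \<longleftrightarrow> p dvd q"
proof
  assume "laurent_of_poly p dvd laurent_of_poly q"
  then obtain g where "laurent_of_poly q = laurent_of_poly p * g" by (auto elim: dvdE)
  moreover obtain k r where g: "g = t_pow k * laurent_of_poly r" using laurent_as_poly by blast
  ultimately have eq: "laurent_of_poly q = t_pow k * laurent_of_poly (p * r)"
    by (simp add: laurent_of_poly_mult algebra_simps)
  show "p dvd q"
  proof (cases "0 \<le> k")
    case True
    then have "laurent_of_poly q = laurent_of_poly (monom 1 (nat k) * (p * r))"
      using eq by (simp add: laurent_of_poly_mult laurent_of_poly_monom)
    then show ?thesis using laurent_of_poly_inj by fastforce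
  next
    case False
    then have "laurent_of_poly (monom 1 (nat (- k)) * q) = laurent_of_poly (p * r)"
      using eq by (simp add: laurent_of_poly_mult laurent_of_poly_monom)
    then have "p dvd monom 1 (nat (- k)) * q" using laurent_of_poly_inj by fastforce
    then show ?thesis by (rule dvd_monom_mult_cancel[OF assms])
  qed
qed (auto simp: laurent_of_poly_mult elim!: dvdE)

lemma laurent_Gcd_exists:
  fixes I :: "laurent set"
  shows "\<exists>d. (\<forall>f\<in>I. d dvd f) \<and> (\<forall>e. (\<forall>f\<in>I. e dvd f) \<longrightarrow> e dvd d)"
proof -
  \<comment> \<open>The polynomials that lie in \<open>I\<close> up to a power of \<open>t\<close>.
    Such powers are units, so the gcd of \<open>S\<close> in the factorial ring \<int>[t] is the
    candidate.\<close>
  define S where "S = {p. \<exists>k. t_pow k * laurent_of_poly p \<in> I}"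
  define d where "d = laurent_of_poly (Gcd_factorial S)"
  have "d dvd f" if "f \<in> I" for f
  proof -
    obtain k p where f: "f = t_pow k * laurent_of_poly p" using laurent_as_poly by blast
    then have "Gcd_factorial S dvd p" using that by (auto simp: S_def intro: Gcd_factorial_dvd)
    then show ?thesis unfolding f d_def t_pow_dvd_iff by (auto simp: laurent_of_poly_mult elim!: dvdE)
  qed
  moreover have "e dvd d" if e: "\<And>f. f \<in> I \<Longrightarrow> e dvd f" for e
  \<comment> \<open>Zero has no normal form with nonzero constant coefficient. If it divides all of
    \<open>I\<close>, then \<open>S\<close> contains at most 0 and the gcd is 0.\<close>
  proof (cases "e = 0")
    case True
    then have "I \<subseteq> {0}" using e by auto
    have "S \<subseteq> {0}"
    proof
      fix p assume "p \<in> S"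
      then obtain k where "t_pow k * laurent_of_poly p = 0" using \<open>I \<subseteq> {0}\<close> by (auto simp: S_def)
      then have "laurent_of_poly p = laurent_of_poly 0" by (metis laurent_of_poly_0 mult_zero_right t_pow_minus_cancel(4))
      then show "p \<in> {0}" using laurent_of_poly_inj by blast
    qed
    then show ?thesis by (simp add: d_def flip: Gcd_factorial_eq_0_iff)
  next
    case False
    then obtain k p where p: "e = t_pow k * laurent_of_poly p" "coeff p 0 \<noteq> 0" using laurent_as_poly[of e] by blast
    have "p dvd q" if q: "q \<in> S" for q
    proof -
      obtain k where "t_pow k * laurent_of_poly q \<in> I" using q by (auto simp: S_def)
      from e[OF this] show ?thesis
        by (simp add: p(1) t_pow_dvd_iff laurent_of_poly_dvd_iff[OF p(2)])
    qed
    then have "p dvd Gcd_factorial S" by (rule Gcd_factorial_greatest)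
    then show ?thesis unfolding p(1) d_def t_pow_dvd_iff by (auto simp: laurent_of_poly_mult elim!: dvdE)
  qed
  ultimately show ?thesis by blast
qed

text \<open>A greatest common divisor of the Fitting ideal generates the smallest principal ideal
  containing it. Existence gives meaning to the choice in
  \<open>twisted_alexander_polynomial\<close>.\<close>

lemma is_order_exists:
  fixes Z B :: "('b \<Rightarrow>\<^sub>0 laurent) set"
  shows "\<exists>d. is_order Z B d"
proof -
  obtain d where "\<forall>f\<in>fitting_ideal Z B. d dvd f"
    "\<forall>e. (\<forall>f\<in>fitting_ideal Z B. e dvd f) \<longrightarrow> e dvd d"
    using laurent_Gcd_exists by blast
  then show ?thesis by (auto simp: is_order_def intro!: exI[of _ d] dest: dvd_trans)
qed

lemma not_monic_laurent_triple: "\<not> monic_laurent (3 * f)"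
proof
  assume "monic_laurent (3 * f)"
  moreover have no: "3 * k \<noteq> 1" "3 * k \<noteq> - 1" for k :: int by presburger+
  moreover have "Poly_Mapping.lookup (3 * f) k = 3 * Poly_Mapping.lookup f k" for k
    using Poly_Mapping.map.rep_eq[of "(*) 3" f] by (simp add: mult_map_scale_conv_mult when_def)
  ultimately show False using no by (auto simp: monic_laurent_def)
qed

section \<open>Functionals and Fitting ideals\<close>

lemma lookup_scale [simp]: "Poly_Mapping.lookup (scale r f) k = r * Poly_Mapping.lookup f k"
  by (simp add: scale_def Poly_Mapping.map.rep_eq when_def)

lemma module_scale: "Modules.module (scale :: 'r::comm_ring_1 \<Rightarrow> ('b \<Rightarrow>\<^sub>0 'r) \<Rightarrow> _)"
  by standard (auto intro!: poly_mapping_eqI simp: lookup_add algebra_simps)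

definition linear_extension :: "('b \<Rightarrow> 'r) \<Rightarrow> ('b \<Rightarrow>\<^sub>0 'r::comm_ring_1) \<Rightarrow> 'r" where
  "linear_extension \<psi> f = (\<Sum>b\<in>Poly_Mapping.keys f. Poly_Mapping.lookup f b * \<psi> b)"

lemma linear_extension_superset:
  assumes "finite S" "Poly_Mapping.keys f \<subseteq> S"
  shows "linear_extension \<psi> f = (\<Sum>b\<in>S. Poly_Mapping.lookup f b * \<psi> b)"
  unfolding linear_extension_def using assms
  by (intro sum.mono_neutral_left) (auto simp: in_keys_iff)

lemma linear_extension_add: "linear_extension \<psi> (f + g) = linear_extension \<psi> f + linear_extension \<psi> g"
proof -
  let ?S = "Poly_Mapping.keys f \<union> Poly_Mapping.keys g"
  have "Poly_Mapping.keys (f + g) \<subseteq> ?S" by (rule keys_add)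
  then show ?thesis
    by (simp add: linear_extension_superset[of ?S] lookup_add distrib_right sum.distrib)
qed

lemma linear_extension_0 [simp]: "linear_extension \<psi> 0 = 0"
  by (simp add: linear_extension_def)

lemma linear_extension_scale: "linear_extension \<psi> (scale r f) = r * linear_extension \<psi> f"
proof -
  have "Poly_Mapping.keys (scale r f) \<subseteq> Poly_Mapping.keys f" by (auto simp: in_keys_iff)
  then show ?thesis
    by (simp add: linear_extension_superset[of "Poly_Mapping.keys f"] sum_distrib_left mult.assoc)
qed

lemma linear_extension_single: "linear_extension \<psi> (Poly_Mapping.single b r) = r * \<psi> b"
  by (simp add: linear_extension_superset[of "{b}"])

lemma linear_extension_sum: "linear_extension \<psi> (\<Sum>i\<in>I. f i) = (\<Sum>i\<in>I. linear_extension \<psi> (f i))"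
  by (induction I rule: infinite_finite_induct) (simp_all add: linear_extension_add)

lemma linear_extension_diff: "linear_extension \<psi> (f - g) = linear_extension \<psi> f - linear_extension \<psi> g"
  by (metis add_diff_cancel_right' diff_add_cancel linear_extension_add)

lemma linear_extension_mult: "linear_extension (\<lambda>b. d * \<psi> b) f = d * linear_extension \<psi> f"
  by (simp add: linear_extension_def sum_distrib_left mult.left_commute)

text \<open>The preimage of the ideal generated by \<open>r\<close> is a submodule, so divisibility
  on a span need only be checked on generators.\<close>

lemma subspace_linear_extension_dvd:
  "module.subspace scale {f. r dvd linear_extension \<psi> f}"
  by (auto simp: module.subspace_def[OF module_scale] linear_extension_add linear_extension_scale)

text \<open>By the adjugate, the determinant of a matrix of relations among generators annihilates
  the image of \<open>Z\<close> under any functional that vanishes on \<open>B\<close> modulo \<open>r\<close>.\<close>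

lemma fitting_ideal_dvd:
  fixes Z B :: "('b \<Rightarrow>\<^sub>0 'r::comm_ring_1) set"
  assumes B: "\<And>b. b \<in> B \<Longrightarrow> r dvd linear_extension \<psi> b"
    and z: "z \<in> Z" "r dvd s * linear_extension \<psi> z - 1"
  shows "fitting_ideal Z B \<subseteq> {d. r dvd d}"
proof -
  interpret R: Modules.module "(*) :: 'r \<Rightarrow> 'r \<Rightarrow> 'r" by standard (auto simp: algebra_simps)
  interpret F: Modules.module "scale :: 'r \<Rightarrow> ('b \<Rightarrow>\<^sub>0 'r) \<Rightarrow> _" by (rule module_scale)
  have "r dvd Determinant.det A"
    if zs: "Z \<subseteq> F.span (set zs \<union> B)" and A: "A \<in> carrier_mat (length zs) (length zs)"
      and rel: "\<And>i. i < length zs \<Longrightarrow> (\<Sum>j<length zs. scale (A $$ (i, j)) (zs ! j)) \<in> B" for A zs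
  proof -
    let ?n = "length zs" and ?d = "Determinant.det A"
    define u where "u j = linear_extension \<psi> (zs ! j)" for j
    have row: "r dvd (\<Sum>j<?n. A $$ (i, j) * u j)" if "i < ?n" for i
      using B[OF rel[OF that]] by (simp add: linear_extension_sum linear_extension_scale u_def)
    note adj = adj_mat[OF A]
    have "r dvd ?d * u k" if k: "k < ?n" for k
    proof -
      have entry: "(\<Sum>i<?n. adj_mat A $$ (k, i) * A $$ (i, j)) = (if j = k then ?d else 0)" if "j < ?n" for j
      proof -
        have "(\<Sum>i<?n. adj_mat A $$ (k, i) * A $$ (i, j)) = (adj_mat A * A) $$ (k, j)"
          using adj(1) A k that by (auto simp: scalar_prod_def lessThan_atLeast0 intro!: sum.cong)
        then show ?thesis unfolding adj(3) using k that by auto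
      qed
      have "?d * u k = (\<Sum>j<?n. (\<Sum>i<?n. adj_mat A $$ (k, i) * A $$ (i, j)) * u j)"
        using k by (simp add: entry if_distrib[of "\<lambda>x. x * _"] cong: if_cong)
      also have "\<dots> = (\<Sum>i<?n. adj_mat A $$ (k, i) * (\<Sum>j<?n. A $$ (i, j) * u j))"
        unfolding sum_distrib_left sum_distrib_right mult.assoc by (rule sum.swap)
      finally show ?thesis by (auto intro!: dvd_sum[OF dvd_mult[OF row]])
    qed
    \<comment> \<open>The functional multiplied by the determinant vanishes modulo \<open>r\<close>
      on all generators, hence on all of \<open>Z\<close>.\<close>
    then have "set zs \<union> B \<subseteq> {f. r dvd linear_extension (\<lambda>b. ?d * \<psi> b) f}"
      using B by (auto simp: in_set_conv_nth u_def linear_extension_mult)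
    then have "F.span (set zs \<union> B) \<subseteq> {f. r dvd linear_extension (\<lambda>b. ?d * \<psi> b) f}"
      by (rule F.span_minimal[OF _ subspace_linear_extension_dvd])
    then have "r dvd ?d * linear_extension \<psi> z"
      using zs z(1) by (auto simp: linear_extension_mult)
    \<comment> \<open>Modulo \<open>r\<close>, \<open>s\<close> inverts the value of the functional
      at \<open>z\<close>, so that value can be cancelled from the product with the
      determinant.\<close>
    moreover have "?d = s * (?d * linear_extension \<psi> z) - ?d * (s * linear_extension \<psi> z - 1)"
      by (simp add: right_diff_distrib mult.left_commute)
    moreover have "r dvd s * (?d * linear_extension \<psi> z) - ?d * (s * linear_extension \<psi> z - 1)"
      by (rule dvd_diff[OF dvd_mult[OF calculation(1)] dvd_mult[OF z(2)]])
    ultimately show ?thesis by simp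
  qed
  then show ?thesis
    unfolding fitting_ideal_def by (intro R.span_minimal) (auto simp: R.subspace_def)
qed

section \<open>The crossed homomorphism on words\<close>

lemma word_value_in_carrier:
  assumes "group G" "f ` S \<subseteq> carrier G" "w \<in> lists (S \<times> UNIV)"
  shows "word_value G f w \<in> carrier G"
proof -
  interpret group G by fact
  show ?thesis using assms(3,2) by (induction w) auto
qed

lemma word_value_append:
  assumes "group G" "f ` S \<subseteq> carrier G" "u \<in> lists (S \<times> UNIV)" "v \<in> lists (S \<times> UNIV)"
  shows "word_value G f (u @ v) = word_value G f u \<otimes>\<^bsub>G\<^esub> word_value G f v"
proof -
  interpret group G by fact
  have v: "word_value G f v \<in> carrier G" using word_value_in_carrier assms by blast
  show ?thesis using assms(3)
  proof (induction u)
    case (Cons l u)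
    then have "word_value G f u \<in> carrier G" "f (fst l) \<in> carrier G"
      using word_value_in_carrier[OF assms(1,2)] assms(2) by auto
    then show ?case using Cons v by (auto simp: m_assoc)
  qed (use v in simp)
qed

section \<open>Permutations, degrees and cocycle values of the generators, and the affine action of
  words\<close>

definition gen_perm :: "gen \<Rightarrow> nat \<Rightarrow> nat" where
  "gen_perm g = one_line (case g of gx \<Rightarrow> [1,4,5,2,3] | gy \<Rightarrow> [3,4,1,2,5] | gn \<Rightarrow> [1,4,5,2,3]
    | gs \<Rightarrow> [1,2,3,4,5] | gt \<Rightarrow> [1,5,2,3,4] | ga \<Rightarrow> [1,5,2,3,4] | gb \<Rightarrow> [1,3,5,2,4])"

text \<open>The inverses are tabulated so that the relations can be checked by plain
  evaluation.\<close>

definition gen_perm_inv :: "gen \<Rightarrow> nat \<Rightarrow> nat" where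
  "gen_perm_inv g = one_line (case g of gx \<Rightarrow> [1,4,5,2,3] | gy \<Rightarrow> [3,4,1,2,5] | gn \<Rightarrow> [1,4,5,2,3]
    | gs \<Rightarrow> [1,2,3,4,5] | gt \<Rightarrow> [1,3,4,5,2] | ga \<Rightarrow> [1,3,4,5,2] | gb \<Rightarrow> [1,4,2,5,3])"

definition gen_degree :: "gen \<Rightarrow> int" where
  "gen_degree g = (if g \<in> {ga, gb, gt} then 1 else 0)"

definition gen_cocycle :: "gen \<Rightarrow> nat \<Rightarrow> laurent" where
  "gen_cocycle g k = (if g = gy then if k = 2 then 1 else if k = 4 then -1 else 0 else 0)"

text \<open>The affine action \<open>f \<mapsto> g f + c(g)\<close> of a generator \<open>g\<close> and of its inverse on functionals, with
  \<open>f k\<close> the value on \<open>e\<^sub>k\<close>, \<open>1 \<le> k \<le> 5\<close>, and \<open>(g f)(g e\<^sub>k) = f(e\<^sub>k)\<close>, hence the factor \<open>t\<^bsup>-\<phi>(g)\<^esup>\<close>.\<close>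

definition letter_act :: "gen \<times> bool \<Rightarrow> (nat \<Rightarrow> laurent) \<Rightarrow> nat \<Rightarrow> laurent" where
  "letter_act l f k = (let g = fst l in
     if snd l then t_pow (- gen_degree g) * f (gen_perm_inv g k) + gen_cocycle g k
     else t_pow (gen_degree g) * (f (gen_perm g k) - gen_cocycle g (gen_perm g k)))"

definition word_act :: "(gen \<times> bool) list \<Rightarrow> (nat \<Rightarrow> laurent) \<Rightarrow> nat \<Rightarrow> laurent" where
  "word_act w = foldr letter_act w"

definition cong3 :: "(nat \<Rightarrow> laurent) \<Rightarrow> (nat \<Rightarrow> laurent) \<Rightarrow> bool" where
  "cong3 f f' \<longleftrightarrow> (\<forall>k\<in>{1..5}. 3 dvd f k - f' k)"

lemma cong3_refl [simp]: "cong3 f f"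
  by (simp add: cong3_def)

lemma cong3_sym: "cong3 f f' \<Longrightarrow> cong3 f' f"
  unfolding cong3_def by (metis dvd_minus_iff minus_diff_eq)

lemma cong3_trans [trans]: "cong3 f f' \<Longrightarrow> cong3 f' f'' \<Longrightarrow> cong3 f f''"
  unfolding cong3_def using dvd_add[of 3 "f _ - f' _" "f' _ - f'' _"] by fastforce

lemma word_act_simps [simp]: "word_act [] f = f" "word_act (l # w) f = letter_act l (word_act w f)"
  "word_act (u @ v) f = word_act u (word_act v f)"
  by (simp_all add: word_act_def)

lemma one_to_five: "(k::nat) \<in> {1..5} \<longleftrightarrow> k = 1 \<or> k = 2 \<or> k = 3 \<or> k = 4 \<or> k = 5"
  by auto

lemma gen_perm_values:
  assumes "k \<in> {1..5}"
  shows "gen_perm g k \<in> {1..5}" "gen_perm_inv g k \<in> {1..5}"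
    "gen_perm g (gen_perm_inv g k) = k" "gen_perm_inv g (gen_perm g k) = k"
  using assms unfolding one_to_five
  by (cases g; auto simp: gen_perm_def gen_perm_inv_def one_line_def)+

lemma letter_act_cong3:
  assumes "cong3 f f'"
  shows "cong3 (letter_act l f) (letter_act l f')"
proof -
  have "letter_act l f k - letter_act l f' k = (if snd l
    then t_pow (- gen_degree (fst l)) * (f (gen_perm_inv (fst l) k) - f' (gen_perm_inv (fst l) k))
    else t_pow (gen_degree (fst l)) * (f (gen_perm (fst l) k) - f' (gen_perm (fst l) k)))" for k
    by (simp add: letter_act_def Let_def algebra_simps)
  then show ?thesis using assms gen_perm_values(1,2) by (simp add: cong3_def)
qed

lemma word_act_cong3: "cong3 f f' \<Longrightarrow> cong3 (word_act w f) (word_act w f')"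
  by (induction w) (simp_all add: letter_act_cong3)

lemma gen_perm_table:
  "gen_perm g (Suc 0) = (case g of gy \<Rightarrow> 3 | _ \<Rightarrow> Suc 0)"
  "gen_perm g 2 = (case g of gx \<Rightarrow> 4 | gy \<Rightarrow> 4 | gn \<Rightarrow> 4 | gs \<Rightarrow> 2 | gb \<Rightarrow> 3 | _ \<Rightarrow> 5)"
  "gen_perm g 3 = (case g of gx \<Rightarrow> 5 | gy \<Rightarrow> Suc 0 | gn \<Rightarrow> 5 | gs \<Rightarrow> 3 | gb \<Rightarrow> 5 | _ \<Rightarrow> 2)"
  "gen_perm g 4 = (case g of gx \<Rightarrow> 2 | gy \<Rightarrow> 2 | gn \<Rightarrow> 2 | gs \<Rightarrow> 4 | gb \<Rightarrow> 2 | _ \<Rightarrow> 3)"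
  "gen_perm g 5 = (case g of gx \<Rightarrow> 3 | gy \<Rightarrow> 5 | gn \<Rightarrow> 3 | gs \<Rightarrow> 5 | gb \<Rightarrow> 4 | _ \<Rightarrow> 4)"
  by (cases g; simp add: gen_perm_def one_line_def)+

lemma gen_perm_inv_table:
  "gen_perm_inv g (Suc 0) = (case g of gy \<Rightarrow> 3 | _ \<Rightarrow> Suc 0)"
  "gen_perm_inv g 2 = (case g of gx \<Rightarrow> 4 | gy \<Rightarrow> 4 | gn \<Rightarrow> 4 | gs \<Rightarrow> 2 | gb \<Rightarrow> 4 | _ \<Rightarrow> 3)"
  "gen_perm_inv g 3 = (case g of gx \<Rightarrow> 5 | gy \<Rightarrow> Suc 0 | gn \<Rightarrow> 5 | gs \<Rightarrow> 3 | gb \<Rightarrow> 2 | _ \<Rightarrow> 4)"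
  "gen_perm_inv g 4 = (case g of gx \<Rightarrow> 2 | gy \<Rightarrow> 2 | gn \<Rightarrow> 2 | gs \<Rightarrow> 4 | gb \<Rightarrow> 5 | _ \<Rightarrow> 5)"
  "gen_perm_inv g 5 = (case g of gx \<Rightarrow> 3 | gy \<Rightarrow> 5 | gn \<Rightarrow> 3 | gs \<Rightarrow> 5 | gb \<Rightarrow> 3 | _ \<Rightarrow> 2)"
  by (cases g; simp add: gen_perm_inv_def one_line_def)+

text \<open>Both \<open>gx\<close> and \<open>gy\<close> swap 2 and 4, so they negate v = e_2 - e_4.
  The words xyx and yxy therefore translate by -v and 2v, which differ by 3v, while the two
  contributions of the longitude word cancel, matching the value 0 at \<open>gs\<close>. As
  \<open>f\<close> is arbitrary, the evaluation also checks that permutations and degrees respect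
  the relations.\<close>

lemma word_act_relation:
  assumes "(u, v) \<in> knot_relations"
  shows "cong3 (word_act u f) (word_act v f)"
  unfolding cong3_def
proof
  fix k :: nat assume k: "k \<in> {1..5}"
  show "3 dvd word_act u f k - word_act v f k"
    using assms k unfolding knot_relations_def one_to_five
    by (elim insertE emptyE disjE; simp add: pos_def longitude_word_def letter_act_def gen_degree_def
        gen_cocycle_def gen_perm_table gen_perm_inv_table right_diff_distrib distrib_left)
qed

lemma word_act_word_eq:
  assumes "word_eq knot_relations u v"
  shows "cong3 (word_act u f) (word_act v f)"
  using assms
\<comment> \<open>In the case \<open>congr\<close> the induction hypothesis is applied to the
  functional already moved by the suffix \<open>r\<close>.\<close>
proof (induction arbitrary: f)
  case (relation u v)
  then show ?case by (rule word_act_relation)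
next
  case (cancel g e)
  have "word_act [(g, e), (g, \<not> e)] f k = f k" if "k \<in> {1..5}" for k
    using gen_perm_values[OF that, of g] by (cases e) (simp_all add: letter_act_def right_diff_distrib distrib_left)
  then show ?case by (simp add: cong3_def)
next
  case (sym u v)
  then show ?case by (blast intro: cong3_sym)
next
  case (trans u v w)
  then show ?case by (blast intro: cong3_trans)
next
  case (congr u v l r)
  then show ?case by (simp add: word_act_cong3)
qed simp

section \<open>The functional on twisted chains\<close>

locale knot_group_representation =
  fixes X :: "'a topology" and p :: 'a and \<gamma> :: "gen \<Rightarrow> (real \<Rightarrow> 'a) set"
    and \<phi> :: "(real \<Rightarrow> 'a) set \<Rightarrow> int" and \<rho> :: "(real \<Rightarrow> 'a) set \<Rightarrow> nat \<Rightarrow> nat"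
  assumes presentation: "has_presentation (fundamental_group X p) UNIV \<gamma> knot_relations"
    and \<phi>_hom: "\<phi> \<in> hom (fundamental_group X p) integer_group"
    and \<phi>_gen: "\<phi> (\<gamma> g) = gen_degree g"
    and \<rho>_hom: "\<rho> \<in> hom (fundamental_group X p) (sym_group 5)"
    and \<rho>_gen: "\<rho> (\<gamma> g) = gen_perm g"
begin

section \<open>The presented group and its homomorphisms to the integers and to the symmetric
  group\<close>

abbreviation G where "G \<equiv> fundamental_group X p"
abbreviation val where "val \<equiv> word_value G \<gamma>"
abbreviation one_class where "one_class \<equiv> path_class X (\<lambda>_. p)"

lemma group_G: "group G" and \<gamma>_range: "range \<gamma> \<subseteq> carrier G"
  and carrier_eq: "carrier G = range val"
  and val_eq_iff: "val u = val w \<longleftrightarrow> word_eq knot_relations u w"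
  using presentation by (auto simp: has_presentation_def)

sublocale G: group G by (rule group_G)

sublocale \<phi>: group_hom G integer_group \<phi>
  using \<phi>_hom by (simp add: group_hom_def group_hom_axioms_def group_G)

sublocale \<rho>: group_hom G "sym_group 5" \<rho>
  using \<rho>_hom by (simp add: group_hom_def group_hom_axioms_def group_G sym_group_is_group)

lemma G_simps [simp]: "carrier G = path_classes X p p" "monoid.mult G = class_mult X" "monoid.one G = one_class"
  by (simp_all add: fundamental_group_def)

lemma val_in_carrier [simp]: "val w \<in> path_classes X p p"
  using carrier_eq by auto

lemma gen_in_carrier [simp]: "\<gamma> g \<in> path_classes X p p"
  using \<gamma>_range by auto

lemma val_append: "val (u @ w) = class_mult X (val u) (val w)"
  using word_value_append[OF group_G \<gamma>_range, of u w] by simp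

lemma \<phi>_mult: "g \<in> path_classes X p p \<Longrightarrow> h \<in> path_classes X p p \<Longrightarrow> \<phi> (class_mult X g h) = \<phi> g + \<phi> h"
  using \<phi>.hom_mult[of g h] by simp

lemma \<rho>_mult: "g \<in> path_classes X p p \<Longrightarrow> h \<in> path_classes X p p \<Longrightarrow> \<rho> (class_mult X g h) = \<rho> g \<circ> \<rho> h"
  using \<rho>.hom_mult[of g h] by (simp add: sym_group_mult)

lemma \<rho>_range: "g \<in> path_classes X p p \<Longrightarrow> k \<in> {1..5} \<Longrightarrow> \<rho> g k \<in> {1..5}"
  using \<rho>.hom_closed[of g] permutes_in_image[of "\<rho> g" "{1..5}" k] by (simp add: sym_group_carrier)

lemma \<phi>_letter: "\<phi> (val [(g, e)]) = (if e then gen_degree g else - gen_degree g)"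
  using \<phi>.hom_inv[of "\<gamma> g"] G.r_one[of "\<gamma> g"] G.r_one[of "inv\<^bsub>G\<^esub> \<gamma> g"] G.inv_closed[of "\<gamma> g"]
  by (simp add: \<phi>_gen)

lemma \<rho>_letter:
  assumes "k \<in> {1..5}"
  shows "\<rho> (val [(g, e)]) k = (if e then gen_perm g k else gen_perm_inv g k)"
proof -
  have "\<rho> (inv\<^bsub>G\<^esub> \<gamma> g) (gen_perm g j) = j" for j
    using \<rho>_mult[of "inv\<^bsub>G\<^esub> \<gamma> g" "\<gamma> g"] G.l_inv[of "\<gamma> g"] G.inv_closed[of "\<gamma> g"] \<rho>.hom_one
    by (simp add: \<rho>_gen sym_group_one fun_eq_iff)
  from this[of "gen_perm_inv g k"] show ?thesis
    using gen_perm_values(3)[OF assms, of g] G.r_one[of "\<gamma> g"] G.r_one[of "inv\<^bsub>G\<^esub> \<gamma> g"] G.inv_closed[of "\<gamma> g"]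
    by (simp add: \<rho>_gen)
qed

lemma letter_act_affine:
  assumes "k \<in> {1..5}"
  shows "letter_act l f (\<rho> (val [l]) k) = t_pow (- \<phi> (val [l])) * f k + letter_act l (\<lambda>_. 0) (\<rho> (val [l]) k)"
proof (cases l)
  case (Pair g e)
  then show ?thesis
    using gen_perm_values[OF assms, of g] unfolding Pair \<phi>_letter \<rho>_letter[OF assms]
    by (simp add: letter_act_def algebra_simps)
qed

text \<open>Letters act by affine maps and these compose: the linear part is dual to the twisted
  representation, the translation part is the image of 0. Evaluation at the permuted index avoids
  inverse permutations.\<close>

lemma word_act_affine:
  assumes "k \<in> {1..5}"
  shows "word_act w f (\<rho> (val w) k) = t_pow (- \<phi> (val w)) * f k + word_act w (\<lambda>_. 0) (\<rho> (val w) k)"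
proof (induction w)
  case Nil
  then show ?case using \<phi>.hom_one \<rho>.hom_one by (simp add: sym_group_one)
next
  case (Cons l w)
  have "\<rho> (val w) k \<in> {1..5}" using \<rho>_range[OF val_in_carrier assms] .
  note letter = letter_act_affine[OF this, of l]
  have "val (l # w) = class_mult X (val [l]) (val w)" using val_append[of "[l]" w] by simp
  then have "\<rho> (val (l # w)) k = \<rho> (val [l]) (\<rho> (val w) k)" "\<phi> (val (l # w)) = \<phi> (val [l]) + \<phi> (val w)"
    by (simp_all add: \<rho>_mult \<phi>_mult del: word_value.simps)
  then show ?case
    unfolding word_act_simps by (simp add: letter[of "word_act w f"] letter[of "word_act w (\<lambda>_. 0)"] Cons
        t_pow_add[symmetric] algebra_simps del: word_value.simps)
qed

section \<open>The crossed homomorphism modulo 3 on the group\<close>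

definition cocycle :: "(real \<Rightarrow> 'a) set \<Rightarrow> nat \<Rightarrow> laurent" where
  "cocycle g = word_act (SOME w. val w = g) (\<lambda>_. 0)"

text \<open>The word chosen by \<open>SOME\<close> and \<open>w\<close> represent the same element,
  so they act alike modulo 3.\<close>

lemma cocycle_val: "cong3 (cocycle (val w)) (word_act w (\<lambda>_. 0))"
proof -
  have "val (SOME u. val u = val w) = val w" by (rule someI) simp
  then show ?thesis unfolding cocycle_def val_eq_iff by (rule word_act_word_eq)
qed

text \<open>Concatenated words for \<open>g\<close> and \<open>h\<close> represent the product, and
  the affine action of the first word splits the result. This is the crossed homomorphism rule c(gh)
  = g c(h) + c(g).\<close>

lemma cocycle_mult:
  assumes g: "g \<in> path_classes X p p" and h: "h \<in> path_classes X p p" and k: "k \<in> {1..5}"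
  shows "3 dvd cocycle (class_mult X g h) (\<rho> g k) - (t_pow (- \<phi> g) * cocycle h k + cocycle g (\<rho> g k))"
proof -
  obtain u w where u: "g = val u" and w: "h = val w" using g h carrier_eq by auto
  have \<rho>k: "\<rho> g k \<in> {1..5}" by (rule \<rho>_range[OF g k])
  have "cong3 (cocycle (class_mult X g h)) (word_act u (word_act w (\<lambda>_. 0)))"
    using cocycle_val[of "u @ w"] by (simp add: val_append u w)
  then have "3 dvd cocycle (class_mult X g h) (\<rho> g k) - (t_pow (- \<phi> g) * word_act w (\<lambda>_. 0) k + word_act u (\<lambda>_. 0) (\<rho> g k))"
    unfolding cong3_def using \<rho>k word_act_affine[OF k, of u "word_act w (\<lambda>_. 0)"] unfolding u by metis
  moreover have "3 dvd t_pow (- \<phi> g) * (cocycle h k - word_act w (\<lambda>_. 0) k)"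
    using cocycle_val[of w] k by (simp add: cong3_def w)
  moreover have "3 dvd cocycle g (\<rho> g k) - word_act u (\<lambda>_. 0) (\<rho> g k)"
    using cocycle_val[of u] \<rho>k by (simp add: cong3_def u)
  ultimately have "3 dvd (cocycle (class_mult X g h) (\<rho> g k) - (t_pow (- \<phi> g) * word_act w (\<lambda>_. 0) k + word_act u (\<lambda>_. 0) (\<rho> g k)))
     - t_pow (- \<phi> g) * (cocycle h k - word_act w (\<lambda>_. 0) k) - (cocycle g (\<rho> g k) - word_act u (\<lambda>_. 0) (\<rho> g k))"
    by (intro dvd_diff[OF dvd_diff])
  then show ?thesis by (simp add: algebra_simps)
qed

lemma one_class_in: "one_class \<in> path_classes X p p"
  using G.one_closed by simp

text \<open>Closing up with a fixed class back to the base point extends the crossed homomorphism to a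
  function \<open>height\<close> on lifted vertices, whose coboundary is the functional on 1-chains.\<close>

definition return_class :: "'a \<Rightarrow> (real \<Rightarrow> 'a) set" where
  "return_class q = (if q = p then one_class else SOME c. c \<in> path_classes X q p)"

lemma return_class_in:
  assumes "c \<in> path_classes X p q"
  shows "return_class q \<in> path_classes X q p"
  using path_classes_reverse[OF assms] one_class_in by (auto simp: return_class_def some_in_eq)

definition height :: "(real \<Rightarrow> 'a) set \<Rightarrow> 'a \<Rightarrow> nat \<Rightarrow> laurent" where
  "height c q = cocycle (class_mult X c (return_class q))"

text \<open>Since (g c) r = g (c r) for the return class r, this is the crossed homomorphism rule
  for \<open>g\<close> and the loop c r.\<close>

lemma height_mult:
  assumes g: "g \<in> path_classes X p p" and c: "c \<in> path_classes X p q" and k: "k \<in> {1..5}"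
  shows "3 dvd height (class_mult X g c) q (\<rho> g k) - (t_pow (- \<phi> g) * height c q k + cocycle g (\<rho> g k))"
  using cocycle_mult[OF g class_mult_in_path_classes[OF c return_class_in[OF c]] k] class_mult_assoc[OF g c return_class_in[OF c]]
  by (simp add: height_def)

text \<open>\<open>Suc i\<close> reconciles two conventions: basis vectors are indexed from 0,
  permutations act on \<open>{1..5}\<close>.\<close>

definition edge_value :: "'a lifted_simplex \<times> nat \<Rightarrow> laurent" where
  "edge_value = (\<lambda>((\<sigma>, c), i). height (class_mult X c (path_class X (first_edge \<sigma>))) (\<sigma> (vertex 1)) (Suc i)
     - height c (\<sigma> (vertex 0)) (Suc i))"

text \<open>Translation by \<open>g\<close> adds the same term \<open>cocycle g (\<rho> g k)\<close>
  to the heights of both ends of the edge, so it cancels in their difference.\<close>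

lemma edge_value_equivariant:
  assumes g: "g \<in> path_classes X p p" and s: "(\<sigma>, c) \<in> lifted_simplices 1 X p" and i: "i < 5"
  shows "3 dvd t_pow (\<phi> g) * edge_value ((\<sigma>, class_mult X g c), \<rho> g (Suc i) - 1) - edge_value ((\<sigma>, c), i)"
proof -
  let ?e = "path_class X (first_edge \<sigma>)" and ?v = "\<sigma> (vertex 0)" and ?w = "\<sigma> (vertex 1)" and ?k = "Suc i"
  have k: "?k \<in> {1..5}" using i by auto
  have c: "c \<in> path_classes X p ?v" and "singular_simplex 1 X \<sigma>"
    using s by (auto simp: lifted_simplices_def)
  then have e: "?e \<in> path_classes X ?v ?w"
    using path_from_to_simplex_edge[of 1 X \<sigma> 0 1] by (auto simp: path_classes_def first_edge_eq)
  note ce = class_mult_in_path_classes[OF c e]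
  have "Suc (\<rho> g ?k - 1) = \<rho> g ?k" using \<rho>_range[OF g k] by auto
  then have "edge_value ((\<sigma>, class_mult X g c), \<rho> g ?k - 1)
    = height (class_mult X g (class_mult X c ?e)) ?w (\<rho> g ?k) - height (class_mult X g c) ?v (\<rho> g ?k)"
    by (simp add: edge_value_def class_mult_assoc[OF g c e])
  then have "t_pow (\<phi> g) * edge_value ((\<sigma>, class_mult X g c), \<rho> g ?k - 1) - edge_value ((\<sigma>, c), i)
    = t_pow (\<phi> g) *
      ((height (class_mult X g (class_mult X c ?e)) ?w (\<rho> g ?k)
          - (t_pow (- \<phi> g) * height (class_mult X c ?e) ?w ?k + cocycle g (\<rho> g ?k)))
       - (height (class_mult X g c) ?v (\<rho> g ?k)
          - (t_pow (- \<phi> g) * height c ?v ?k + cocycle g (\<rho> g ?k))))"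
    by (simp add: edge_value_def right_diff_distrib distrib_left)
  then show ?thesis
    using dvd_mult[OF dvd_diff[OF height_mult[OF g ce k] height_mult[OF g c k]]] by presburger
qed

section \<open>Vanishing modulo 3 on the twisted boundaries\<close>

lemma action_sum:
  assumes g: "g \<in> path_classes X p p" and i: "i < 5"
  shows "(\<Sum>j<5. Poly_Mapping.single (s, j) (of_int ((permutation_matrix 5 \<circ> \<rho>) g $$ (j, i)) * t_pow (\<phi> g)))
    = Poly_Mapping.single (s, \<rho> g (Suc i) - 1) (t_pow (\<phi> g))"
proof -
  have r: "\<rho> g (Suc i) \<in> {1..5}" using \<rho>_range[OF g, of "Suc i"] i by auto
  \<comment> \<open>Column \<open>i\<close> of the permutation matrix has its only nonzero entry in
    row \<open>\<rho> g (Suc i) - 1\<close>.\<close>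
  have "(\<Sum>j<5. Poly_Mapping.single (s, j) (of_int ((permutation_matrix 5 \<circ> \<rho>) g $$ (j, i)) * t_pow (\<phi> g)))
    = (\<Sum>j<5. if j = \<rho> g (Suc i) - 1 then Poly_Mapping.single (s, j) (t_pow (\<phi> g)) else 0)"
    using i r by (intro sum.cong) (auto simp: permutation_matrix_def)
  also have "\<dots> = Poly_Mapping.single (s, \<rho> g (Suc i) - 1) (t_pow (\<phi> g))"
    using r by (subst sum.delta) auto
  finally show ?thesis .
qed

text \<open>Equivariance lets the functional descend, modulo 3, from chains of the universal cover
  to twisted chains.\<close>

lemma action_relations_dvd:
  assumes "f \<in> action_relations 1 X p 5 \<phi> (permutation_matrix 5 \<circ> \<rho>)"
  shows "3 dvd linear_extension edge_value f"
proof -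
  have "action_relations 1 X p 5 \<phi> (permutation_matrix 5 \<circ> \<rho>) \<subseteq> {f. 3 dvd linear_extension edge_value f}"
    unfolding action_relations_def
  proof (rule module.span_minimal[OF module_scale _ subspace_linear_extension_dvd], clarify)
    fix g \<sigma> c and i :: nat
    assume "g \<in> carrier G" "(\<sigma>, c) \<in> lifted_simplices 1 X p" "i < 5"
    then show "3 dvd linear_extension edge_value
      ((\<Sum>j<5. Poly_Mapping.single ((\<sigma>, class_mult X g c), j)
          (of_int ((permutation_matrix 5 \<circ> \<rho>) g $$ (j, i)) * t_pow (\<phi> g)))
        - Poly_Mapping.single ((\<sigma>, c), i) 1)"
      using edge_value_equivariant[of g \<sigma> c i] action_sum[of g i "(\<sigma>, class_mult X g c)"]
      by (simp add: linear_extension_diff linear_extension_single)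
  qed
  with assms show ?thesis by blast
qed

text \<open>The functional is a coboundary, so the heights of the three lifted vertices of a
  2-simplex cancel in pairs; this holds exactly, not just modulo 3.\<close>

lemma boundary_edge_value:
  assumes "h \<in> chains 2 X p 5"
  shows "linear_extension edge_value (boundary 2 X h) = 0"
proof -
  have "(\<Sum>m\<le>2. (- 1) ^ m * r * edge_value (lifted_face 2 X m (\<sigma>, c), i)) = 0"
    if s: "(\<sigma>, c) \<in> lifted_simplices 2 X p" for \<sigma> c i and r :: laurent
  proof -
    let ?e = "\<lambda>j k. path_class X (\<sigma> \<circ> lin_seg (vertex j) (vertex k))"
    have \<sigma>: "singular_simplex 2 X \<sigma>" and c: "c \<in> path_classes X p (\<sigma> (vertex 0))"
      using s by (auto simp: lifted_simplices_def)
    have e: "?e j k \<in> path_classes X (\<sigma> (vertex j)) (\<sigma> (vertex k))" if "j \<le> 2" "k \<le> 2" for j k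
      using path_from_to_simplex_edge[OF \<sigma> that] by (auto simp: path_classes_def)
    \<comment> \<open>Reaching vertex 2 directly or through vertex 1 gives the same lift, so its two
      heights coincide.\<close>
    have "class_mult X (class_mult X c (?e 0 1)) (?e 1 2) = class_mult X c (?e 0 2)"
      using class_mult_assoc[OF c e[of 0 1] e[of 1 2]] simplex_edges_homotopic[OF \<sigma>] by simp
    moreover have "singular_face 2 m \<sigma> (vertex i) = \<sigma> (vertex (if i < m then i else Suc i))"
      if "i \<le> 1" "m \<le> 2" for i m
      using singular_face_vertex[of i 1 m \<sigma>] that by (simp add: numeral_2_eq_2)
    ultimately show ?thesis
      using singular_face_edge[OF \<sigma>, of 0] singular_face_edge[OF \<sigma>, of 1] singular_face_edge[OF \<sigma>, of 2]
      by (simp add: numeral_2_eq_2 lifted_face_def edge_value_def first_edge_eq[of \<sigma>] algebra_simps)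
  qed
  then have "linear_extension edge_value (\<Sum>m\<le>2. Poly_Mapping.single (lifted_face 2 X m s, i)
      ((- 1) ^ m * Poly_Mapping.lookup h (s, i))) = 0"
    if "(s, i) \<in> Poly_Mapping.keys h" for s i
    using that assms by (cases s) (auto simp: chains_def linear_extension_sum linear_extension_single)
  then show ?thesis
    unfolding boundary_def linear_extension_sum split_beta
    by (simp add: linear_extension_sum) (rule sum.neutral, auto)
qed

lemma boundaries_dvd:
  assumes "f \<in> twisted_boundaries 1 X p 5 \<phi> (permutation_matrix 5 \<circ> \<rho>)"
  shows "3 dvd linear_extension edge_value f"
  using assms boundary_edge_value action_relations_dvd
  by (auto simp: twisted_boundaries_def linear_extension_add numeral_2_eq_2)

section \<open>A cycle whose value is -1 modulo 3\<close>

definition loop_simplex :: "(real \<Rightarrow> 'a) \<Rightarrow> (nat \<Rightarrow> real) \<Rightarrow> 'a" where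
  "loop_simplex c = restrict (\<lambda>x. c (x 1)) (standard_simplex 1)"

lemma loop_simplex:
  assumes "path_from_to X p p c"
  shows "singular_simplex 1 X (loop_simplex c)"
    "loop_simplex c (vertex 0) = p" "loop_simplex c (vertex 1) = p"
    "path_class X (first_edge (loop_simplex c)) = path_class X c"
proof -
  let ?S = "subtopology (powertop_real UNIV) (standard_simplex 1)"
  have "continuous_map ?S unit_interval (\<lambda>x. x 1)"
    by (auto simp: continuous_map_in_subtopology standard_simplex_def
        intro!: continuous_map_from_subtopology continuous_map_product_projection)
  then have "continuous_map ?S X (c \<circ> (\<lambda>x. x 1))"
    using assms by (auto simp: path_from_to_def pathin_def intro: continuous_map_compose)
  \<comment> \<open>Singular simplices must be extensional on the standard simplex, which
    \<open>restrict\<close> ensures.\<close>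
  then show "singular_simplex 1 X (loop_simplex c)"
    unfolding singular_simplex_def loop_simplex_def by (auto intro: continuous_map_eq)
  show "loop_simplex c (vertex 0) = p" "loop_simplex c (vertex 1) = p"
    using assms vertex_in_standard_simplex[of 0 1] vertex_in_standard_simplex[of 1 1]
    by (auto simp: loop_simplex_def path_from_to_def vertex_def)
  have "first_edge (loop_simplex c) s = c s" if "s \<in> {0..1}" for s
    using lin_seg_in_standard_simplex[of 0 1 1 s] that
    by (simp add: first_edge_eq loop_simplex_def) (simp add: lin_seg_def vertex_def)
  then show "path_class X (first_edge (loop_simplex c)) = path_class X c"
    using assms by (intro path_class_cong[symmetric]) (auto simp: path_from_to_def)
qed

text \<open>Both faces lie over the constant 0-simplex at \<open>p\<close>. Face 0 is the endpoint
  of the lifted loop, so its lift is the class of \<open>c\<close>; face 1 keeps the trivial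
  lift.\<close>

lemma loop_simplex_face:
  assumes "path_from_to X p p c" "m \<le> 1"
  shows "lifted_face 1 X m (loop_simplex c, one_class)
    = (restrict (\<lambda>_. p) (standard_simplex 0), if m = 0 then path_class X c else one_class)"
proof -
  have "singular_face 1 m (loop_simplex c) x = restrict (\<lambda>_. p) (standard_simplex 0) x" for x
  proof (cases "x \<in> standard_simplex 0")
    case True
    then have "x = vertex 0" by (auto simp: standard_simplex_0 vertex_def)
    then show ?thesis
      using True singular_face_vertex[of 0 0 m "loop_simplex c"] loop_simplex(2,3)[OF assms(1)] assms(2)
      by simp
  qed (simp add: singular_face_def)
  then have "singular_face 1 m (loop_simplex c) = restrict (\<lambda>_. p) (standard_simplex 0)"
    by (rule ext)
  moreover have "path_class X c \<in> path_classes X p p"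
    using assms(1) by (auto simp: path_classes_def)
  ultimately show ?thesis
    using G.l_one[of "path_class X c"] by (simp add: lifted_face_def loop_simplex(4)[OF assms(1)])
qed

lemma exists_cycle:
  "\<exists>z\<in>twisted_cycles 1 X p 5 \<phi> (permutation_matrix 5 \<circ> \<rho>). 3 dvd - 1 * linear_extension edge_value z - 1"
proof -
  obtain cx cy where cx: "\<gamma> gx = path_class X cx" "path_from_to X p p cx"
    and cy: "\<gamma> gy = path_class X cy" "path_from_to X p p cy"
    using gen_in_carrier[of gx] gen_in_carrier[of gy] unfolding path_classes_def by blast
  \<comment> \<open>Index 3 is the basis vector e_4.\<close>
  let ?bx = "((loop_simplex cx, one_class), 3 :: nat)" and ?by = "((loop_simplex cy, one_class), 3 :: nat)"
  define z :: "'a twisted_chain" where "z = Poly_Mapping.single ?by 1 - Poly_Mapping.single ?bx 1"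
  define pt where "pt = restrict (\<lambda>_. p) (standard_simplex 0)"
  \<comment> \<open>The permutations differ at 1, so the two basis elements are distinct and the
    coefficients of \<open>z\<close> can be read off.\<close>
  have "\<gamma> gx \<noteq> \<gamma> gy"
    using \<rho>_gen[of gx] \<rho>_gen[of gy] gen_perm_table(1)[of gx] gen_perm_table(1)[of gy] by auto
  then have ne: "?bx \<noteq> ?by"
    using loop_simplex(4)[OF cx(2)] loop_simplex(4)[OF cy(2)] cx(1) cy(1) by auto
  have keys: "Poly_Mapping.keys z = {?bx, ?by}"
    and lookup: "Poly_Mapping.lookup z ?bx = - 1" "Poly_Mapping.lookup z ?by = 1"
    using ne by (auto simp: z_def in_keys_iff lookup_minus lookup_single when_def split: if_splits)
  have lifted: "(loop_simplex cx, one_class) \<in> lifted_simplices 1 X p" "(loop_simplex cy, one_class) \<in> lifted_simplices 1 X p"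
    using loop_simplex[OF cx(2)] loop_simplex[OF cy(2)] one_class_in by (auto simp: lifted_simplices_def)
  have "boundary 1 X z = Poly_Mapping.single ((pt, \<gamma> gy), 3) 1 - Poly_Mapping.single ((pt, \<gamma> gx), 3) 1"
    using ne loop_simplex_face[OF cx(2)] loop_simplex_face[OF cy(2)]
    by (simp add: boundary_def keys lookup pt_def cx(1) cy(1) single_uminus)
  also have "\<dots> \<in> action_relations 0 X p 5 \<phi> (permutation_matrix 5 \<circ> \<rho>)"
  proof -
    have pt: "(pt, one_class) \<in> lifted_simplices 0 X p"
      using one_class_in path_start_in_topspace[of X cx] cx(2) vertex_in_standard_simplex[of 0 0]
      by (auto simp: lifted_simplices_def pt_def singular_simplex_def path_from_to_def continuous_map_const
          intro: continuous_map_eq[of _ _ "\<lambda>_. p"])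
    \<comment> \<open>Both \<open>gx\<close> and \<open>gy\<close> have degree 0 and send e_2 (index
      1) to e_4, so both endpoints are identified with e_2 over the trivial lift, and their
      difference is a relation.\<close>
    have "Poly_Mapping.single ((pt, \<gamma> g), 3) 1 - Poly_Mapping.single ((pt, one_class), 1) 1
      \<in> action_relations 0 X p 5 \<phi> (permutation_matrix 5 \<circ> \<rho>)" if "g \<in> {gx, gy}" for g
    proof -
      have "\<rho> (\<gamma> g) 2 = 4" "\<phi> (\<gamma> g) = 0"
        using that by (auto simp: \<rho>_gen \<phi>_gen gen_perm_table gen_degree_def)
      then have "Poly_Mapping.single ((pt, \<gamma> g), 3) 1
        = (\<Sum>j<5. Poly_Mapping.single ((pt, class_mult X (\<gamma> g) one_class), j)
          (of_int ((permutation_matrix 5 \<circ> \<rho>) (\<gamma> g) $$ (j, 1)) * t_pow (\<phi> (\<gamma> g))))"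
        using action_sum[of "\<gamma> g" 1 "(pt, class_mult X (\<gamma> g) one_class)"] G.r_one[of "\<gamma> g"]
        by (simp add: numeral_2_eq_2)
      then show ?thesis
        unfolding action_relations_def
        by (intro module.span_base[OF module_scale] CollectI exI[of _ "\<gamma> g"] exI[of _ pt]
            exI[of _ one_class] exI[of _ 1]) (use pt in simp)
    qed
    from module.span_diff[OF module_scale, OF this[of gy, unfolded action_relations_def] this[of gx, unfolded action_relations_def]]
    show ?thesis unfolding action_relations_def by simp
  qed
  finally have "z \<in> twisted_cycles 1 X p 5 \<phi> (permutation_matrix 5 \<circ> \<rho>)"
    using lifted by (simp add: twisted_cycles_def chains_def keys)
  \<comment> \<open>Both loops end at \<open>p\<close>, where the return class is trivial; the
    height of the common initial lift cancels.\<close>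
  moreover have "linear_extension edge_value z = cocycle (\<gamma> gy) 4 - cocycle (\<gamma> gx) 4"
    using G.l_one[of "\<gamma> gx"] G.l_one[of "\<gamma> gy"] G.r_one[of "\<gamma> gx"] G.r_one[of "\<gamma> gy"]
      loop_simplex[OF cx(2)] loop_simplex[OF cy(2)] gen_in_carrier[of gx] gen_in_carrier[of gy]
    by (simp add: z_def linear_extension_diff linear_extension_single edge_value_def height_def return_class_def cx(1) cy(1))
  moreover have "val [(g, True)] = \<gamma> g" for g
    using G.r_one[of "\<gamma> g"] by simp
  \<comment> \<open>One-letter words recover the prescribed values, 0 for \<open>gx\<close> and -1
    for \<open>gy\<close> at 4. The value of \<open>z\<close> is thus -1 modulo 3, with inverse
    -1.\<close>
  then have "3 dvd cocycle (\<gamma> g) 4 - gen_cocycle g 4" for g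
    using cocycle_val[of "[(g, True)]"] by (simp add: cong3_def letter_act_def del: word_value.simps)
  from dvd_diff[OF this[of gx] this[of gy]]
  have "3 dvd (cocycle (\<gamma> gx) 4 - gen_cocycle gx 4) - (cocycle (\<gamma> gy) 4 - gen_cocycle gy 4)" .
  ultimately show ?thesis
    by (intro bexI[of _ z]) (simp_all add: gen_cocycle_def diff_diff_add)
qed

lemma not_monic:
  "\<not> monic_laurent (twisted_alexander_polynomial X p 5 \<phi> (permutation_matrix 5 \<circ> \<rho>))"
proof -
  let ?Z = "twisted_cycles 1 X p 5 \<phi> (permutation_matrix 5 \<circ> \<rho>)"
  let ?B = "twisted_boundaries 1 X p 5 \<phi> (permutation_matrix 5 \<circ> \<rho>)"
  let ?d = "twisted_alexander_polynomial X p 5 \<phi> (permutation_matrix 5 \<circ> \<rho>)"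
  obtain z where z: "z \<in> ?Z" "3 dvd - 1 * linear_extension edge_value z - 1"
    using exists_cycle by blast
  have "fitting_ideal ?Z ?B \<subseteq> {r. 3 dvd r}"
  proof (rule fitting_ideal_dvd)
    show "3 dvd linear_extension edge_value f" if "f \<in> ?B" for f
      using that by (rule boundaries_dvd)
  qed (rule z)+
  moreover have "is_order ?Z ?B ?d"
    unfolding twisted_alexander_polynomial_def by (rule someI_ex[OF is_order_exists])
  \<comment> \<open>Minimality of the order: the ideal generated by 3 contains the Fitting ideal,
    hence also the one generated by the order.\<close>
  ultimately have "{r. ?d dvd r} \<subseteq> {r. 3 dvd r}"
    unfolding is_order_def by (elim conjE allE[of _ 3]) (erule mp)
  then have "3 dvd ?d"
    by (rule subsetD[THEN CollectD]) simp
  then show ?thesis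
    using not_monic_laurent_triple by (auto elim!: dvdE)
qed

end

theorem theorem1p5:
  fixes \<tau>\<^sub>0 \<tau>\<^sub>1 \<tau>\<^sub>2 \<tau>\<^sub>L \<tau>\<^sub>R :: "complex \<times> complex \<Rightarrow> complex \<times> complex"
    and M\<^sub>1 :: "'b topology" and M X :: "'a topology"
    and h h\<^sub>L h\<^sub>R :: "complex \<times> complex \<Rightarrow> 'a"
    and q :: "complex \<times> complex" and p :: 'a
    and \<gamma> :: "gen \<Rightarrow> (real \<Rightarrow> 'a) set"
    and \<phi> :: "(real \<Rightarrow> 'a) set \<Rightarrow> int"
    and \<rho> :: "(real \<Rightarrow> 'a) set \<Rightarrow> nat \<Rightarrow> nat"
    and \<alpha> :: "(real \<Rightarrow> 'a) set \<Rightarrow> int mat"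
  assumes knot: "spliced_necklace \<tau>\<^sub>0 \<tau>\<^sub>1 \<tau>\<^sub>2 \<tau>\<^sub>L \<tau>\<^sub>R M\<^sub>1 M h h\<^sub>L h\<^sub>R"
    and exterior: "X = remove_nbhd M (h \<circ> \<tau>\<^sub>2)" and base_point: "p = h q"
    and generators: "standard_generators \<tau>\<^sub>0 \<tau>\<^sub>1 \<tau>\<^sub>2 \<tau>\<^sub>L \<tau>\<^sub>R X h h\<^sub>L h\<^sub>R q \<gamma>"
    and presentation: "has_presentation (fundamental_group X p) UNIV \<gamma> knot_relations"
    and \<phi>_hom: "\<phi> \<in> hom (fundamental_group X p) integer_group"
    and \<phi>_values: "\<phi> (\<gamma> gx) = 0" "\<phi> (\<gamma> gy) = 0" "\<phi> (\<gamma> gn) = 0" "\<phi> (\<gamma> gs) = 0"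
      "\<phi> (\<gamma> ga) = 1" "\<phi> (\<gamma> gb) = 1" "\<phi> (\<gamma> gt) = 1"
    and \<rho>_hom: "\<rho> \<in> hom (fundamental_group X p) (sym_group 5)"
    and \<rho>_values:
      "\<rho> (\<gamma> ga) = one_line [1,5,2,3,4]" "\<rho> (\<gamma> gb) = one_line [1,3,5,2,4]"
      "\<rho> (\<gamma> gn) = one_line [1,4,5,2,3]" "\<rho> (\<gamma> gs) = one_line [1,2,3,4,5]"
      "\<rho> (\<gamma> gt) = one_line [1,5,2,3,4]" "\<rho> (\<gamma> gx) = one_line [1,4,5,2,3]"
      "\<rho> (\<gamma> gy) = one_line [3,4,1,2,5]"
    and \<alpha>: "\<alpha> = permutation_matrix 5 \<circ> \<rho>"
  shows "\<not> monic_laurent (twisted_alexander_polynomial X p 5 \<phi> \<alpha>)"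
proof -
  have "\<phi> (\<gamma> g) = gen_degree g" for g
    using \<phi>_values by (cases g) (simp_all add: gen_degree_def)
  moreover have "\<rho> (\<gamma> g) = gen_perm g" for g
    using \<rho>_values by (cases g) (simp_all add: gen_perm_def)
  ultimately interpret knot_group_representation X p \<gamma> \<phi> \<rho>
    using presentation \<phi>_hom \<rho>_hom by unfold_locales
  show ?thesis
    unfolding \<alpha> by (rule not_monic)
qed

end
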